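(* Let $n\ge1$ be such that $n-1$ or $n-2$ is a triangular number. Then the $n$-vertex trees $T$ minimizing $\mathring{s}(T)$ among all $n$-vertex trees are exactly the trees in $\{K_{1,n-1},S_{1,n-3},S_{2,n-4},S'_{1,n-4}\}$ (those of these that are defined, i.e. all subscripts of double-stars being at least $1$), except that for $n=7$ every $7$-vertex tree is a minimizer, and for $n=11$ the trees $S_{4,5}$ and $S'_{4,4}$ are minimizers as well.
   Context: Slow-coloring game on a finite graph $G$: in each round Lister marks a nonempty set $M$ of currently uncolored vertices, scoring $|M|$ points; Painter then colors a subset of $M$ independent in $G$. The game ends when all vertices are colored. Painter minimizes and Lister maximizes the total score; the sum-color cost $\mathring{s}(G)$ is the value of the game. Triangular numbers are $t_k=\binom{k+1}{2}$ for integers $k\ge1$. $K_{1,n-1}$ is the star with $n-1$ leaves. For $a,b\ge1$, the double-star $S_{a,b}$ is the tree with $a+b+2$ vertices having exactly two non-leaf vertices, adjacent to each other, one with $a$ leaf neighbors and the other with $b$ leaf neighbors; the subdivided double-star $S'_{a,b}$ is obtained from $S_{a,b}$ by subdividing the edge between the two non-leaf vertices with one new vertex. *)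

theory Defs
  imports "Graph_Theory.Graph_Theory"
begin

text \<open>
  Finite simple graphs are the loop-free symmetric pair digraphs of the locale
  \<^locale>\<open>pair_graph\<close>: an edge is represented by its two opposite arcs.
\<close>

definition indep_set :: "'a pair_pre_digraph \<Rightarrow> 'a set \<Rightarrow> bool" where
  "indep_set G I \<longleftrightarrow> (\<forall>u\<in>I. \<forall>v\<in>I. (u, v) \<notin> parcs G)"


section \<open>The slow-coloring game\<close>

text \<open>
  In both predicates \<open>U\<close> is the set of uncolored vertices.

  \<open>painter_holds G U k\<close>: Painter can play from \<open>U\<close> so that the game ends and Lister scores at
  most \<open>k\<close> from now on. Painter may color the empty set; since Lister's marks are nonempty and
  use up the budget \<open>k\<close>, Painter cannot postpone the end of the game forever.

  \<open>lister_forces G U k\<close>: Lister can play from \<open>U\<close> so as to score at least \<open>k\<close> from now on. The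
  truncated subtraction is intended: a target that is already met becomes \<open>0\<close>.
\<close>

inductive painter_holds :: "'a pair_pre_digraph \<Rightarrow> 'a set \<Rightarrow> nat \<Rightarrow> bool" for G where
  respond: "(\<And>M. M \<subseteq> U \<Longrightarrow> M \<noteq> {} \<Longrightarrow> card M \<le> k
      \<and> (\<exists>I\<subseteq>M. indep_set G I \<and> painter_holds G (U - I) (k - card M)))
    \<Longrightarrow> painter_holds G U k"

inductive lister_forces :: "'a pair_pre_digraph \<Rightarrow> 'a set \<Rightarrow> nat \<Rightarrow> bool" for G where
  met: "lister_forces G U 0"
| mark: "M \<subseteq> U \<Longrightarrow> M \<noteq> {}
    \<Longrightarrow> (\<And>I. I \<subseteq> M \<Longrightarrow> indep_set G I \<Longrightarrow> lister_forces G (U - I) (k - card M))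
    \<Longrightarrow> lister_forces G U k"

definition sum_color_cost :: "'a pair_pre_digraph \<Rightarrow> nat" where
  "sum_color_cost G =
    (THE v. painter_holds G (pverts G) v \<and> lister_forces G (pverts G) v)"

text \<open>The game has a value on every finite simple graph.\<close>

lemma painter_holds_mono: "painter_holds G U k \<Longrightarrow> k \<le> k' \<Longrightarrow> painter_holds G U k'"
proof (induction arbitrary: k' rule: painter_holds.induct)
  case (respond U k)
  show ?case
  proof (rule painter_holds.respond)
    fix M assume M: "M \<subseteq> U" "M \<noteq> {}"
    from respond.IH[OF M] obtain I where "card M \<le> k" "I \<subseteq> M" "indep_set G I"
      and I: "\<And>j. k - card M \<le> j \<Longrightarrow> painter_holds G (U - I) j" by blast
    moreover have "painter_holds G (U - I) (k' - card M)"
      using respond.prems by (intro I) simp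
    ultimately show "card M \<le> k'
        \<and> (\<exists>I\<subseteq>M. indep_set G I \<and> painter_holds G (U - I) (k' - card M))"
      using respond.prems by auto
  qed
qed

lemma painter_not_lister: "painter_holds G U k \<Longrightarrow> k < j \<Longrightarrow> \<not> lister_forces G U j"
proof (induction arbitrary: j rule: painter_holds.induct)
  case (respond U k)
  show ?case
  proof
    assume "lister_forces G U j"
    then show False
    proof cases
      case met
      then show False using respond.prems by simp
    next
      case (mark M)
      from respond.IH[OF mark(1,2)] obtain I where "card M \<le> k" "I \<subseteq> M" "indep_set G I"
        and I: "\<And>i. k - card M < i \<Longrightarrow> \<not> lister_forces G (U - I) i" by blast
      with mark(3)[of I] I[of "j - card M"] respond.prems show False by simp
    qed
  qed
qed

lemma lister_if_not_painter:
  assumes "finite U" "\<not> painter_holds G U k"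
  shows "lister_forces G U (Suc k)"
  using assms
proof (induction k arbitrary: U rule: less_induct)
  case (less k)
  from less.prems(2) obtain M where M: "M \<subseteq> U" "M \<noteq> {}"
    and no: "\<And>I. card M \<le> k \<Longrightarrow> I \<subseteq> M \<Longrightarrow> indep_set G I
      \<Longrightarrow> \<not> painter_holds G (U - I) (k - card M)"
    using painter_holds.respond[of U k G] by blast
  have pos: "0 < card M"
    using M less.prems(1) finite_subset by (auto simp: card_gt_0_iff)
  show ?case
  proof (rule lister_forces.mark[OF M])
    fix I assume I: "I \<subseteq> M" "indep_set G I"
    show "lister_forces G (U - I) (Suc k - card M)"
    proof (cases "card M \<le> k")
      case True
      have "lister_forces G (U - I) (Suc (k - card M))"
        using True pos less.prems(1) by (intro less.IH no I) auto
      then show ?thesis using True by (simp add: Suc_diff_le)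
    next
      case False
      then show ?thesis by (simp add: lister_forces.met)
    qed
  qed
qed

lemma painter_holds_square:
  assumes "pair_graph G" "finite U"
  shows "painter_holds G U (card U * card U)"
  using assms(2)
proof (induction "card U" arbitrary: U rule: less_induct)
  case less
  show ?case
  proof (rule painter_holds.respond)
    fix M assume M: "M \<subseteq> U" "M \<noteq> {}"
    then obtain x where x: "x \<in> M" by blast
    have le: "card M \<le> card U" using M less.prems by (simp add: card_mono)
    have x': "card (U - {x}) = card U - 1" and pos: "0 < card U"
      using x M less.prems by (auto simp: card_gt_0_iff card_Diff_singleton_if)
    interpret pair_graph G by fact
    have "indep_set G {x}" unfolding indep_set_def using pair_no_loops by fastforce
    moreover have "painter_holds G (U - {x}) (card U * card U - card M)"
    proof (rule painter_holds_mono)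
      show "painter_holds G (U - {x}) (card (U - {x}) * card (U - {x}))"
        using less.hyps[of "U - {x}"] less.prems x' pos by simp
      show "card (U - {x}) * card (U - {x}) \<le> card U * card U - card M"
        using le pos unfolding x' by (cases "card U") auto
    qed
    moreover have "card M \<le> card U * card U"
      using le pos by (meson le_square le_trans)
    ultimately show "card M \<le> card U * card U
        \<and> (\<exists>I\<subseteq>M. indep_set G I \<and> painter_holds G (U - I) (card U * card U - card M))"
      using x by blast
  qed
qed

theorem game_has_value:
  assumes "pair_graph G"
  shows "\<exists>!v. painter_holds G (pverts G) v \<and> lister_forces G (pverts G) v"
proof -
  interpret pair_graph G by fact
  define v where "v = (LEAST v. painter_holds G (pverts G) v)"
  have holds: "painter_holds G (pverts G) v"
    unfolding v_def using painter_holds_square[OF assms pair_finite_verts] by (rule LeastI)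
  have "lister_forces G (pverts G) v"
  proof (cases v)
    case 0
    then show ?thesis by (simp add: lister_forces.met)
  next
    case (Suc k)
    then have "\<not> painter_holds G (pverts G) k"
      unfolding v_def by (intro not_less_Least) simp
    then show ?thesis unfolding Suc by (intro lister_if_not_painter pair_finite_verts)
  qed
  with holds show ?thesis
    using painter_not_lister by (metis linorder_neqE_nat)
qed


section \<open>Trees, stars and double-stars\<close>

text \<open>
  The predicate \<^const>\<open>tree\<close> of the library is not usable here: in a symmetric digraph each pair
  of opposite arcs is a \<^const>\<open>pre_digraph.cycle\<close> of length two. Cycles of an undirected graph
  are those of length at least three.
\<close>

definition is_tree :: "'a pair_pre_digraph \<Rightarrow> bool" where
  "is_tree G \<longleftrightarrow> pair_graph G \<and> connected (with_proj G)
    \<and> \<not> (\<exists>p. pre_digraph.cycle (with_proj G) p \<and> 3 \<le> length p)"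

definition leaf :: "'a pair_pre_digraph \<Rightarrow> 'a \<Rightarrow> bool" where
  "leaf G v \<longleftrightarrow> v \<in> pverts G \<and> out_degree (with_proj G) v = 1"

definition leaf_neighbors :: "'a pair_pre_digraph \<Rightarrow> 'a \<Rightarrow> 'a set" where
  "leaf_neighbors G v = {w. (v, w) \<in> parcs G \<and> leaf G w}"

definition double_star_centers :: "nat \<Rightarrow> nat \<Rightarrow> 'a pair_pre_digraph \<Rightarrow> 'a \<Rightarrow> 'a \<Rightarrow> bool" where
  "double_star_centers a b G u v \<longleftrightarrow>
    1 \<le> a \<and> 1 \<le> b \<and> is_tree G \<and> card (pverts G) = a + b + 2
    \<and> {x \<in> pverts G. \<not> leaf G x} = {u, v} \<and> u \<noteq> v \<and> (u, v) \<in> parcs G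
    \<and> card (leaf_neighbors G u) = a \<and> card (leaf_neighbors G v) = b"

text \<open>
  The next two predicates, like \<^const>\<open>complete_bipartite_digraph\<close> of the library, say that a
  graph is a copy of \<open>S_{a,b}\<close> or \<open>S'_{a,b}\<close>. They hold for no graph if \<open>a = 0\<close> or \<open>b = 0\<close>.
\<close>

definition double_star :: "nat \<Rightarrow> nat \<Rightarrow> 'a pair_pre_digraph \<Rightarrow> bool" where
  "double_star a b G \<longleftrightarrow> (\<exists>u v. double_star_centers a b G u v)"

definition subdivided_double_star :: "nat \<Rightarrow> nat \<Rightarrow> 'a pair_pre_digraph \<Rightarrow> bool" where
  "subdivided_double_star a b G \<longleftrightarrow>
    (\<exists>H u v w. double_star_centers a b H u v \<and> w \<notin> pverts H \<and> G = subdivide H (u, v) w)"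

definition triangular :: "nat \<Rightarrow> bool" where
  "triangular m \<longleftrightarrow> (\<exists>k\<ge>1. m = (k + 1) choose 2)"

end

theory Submission
  imports Defs
begin

text \<open>
  Write \<open>t_k\<close> for the triangular numbers and \<open>e(T)\<close> for the cost of \<open>T\<close> minus its number of
  vertices. A star with \<open>r\<close> leaves has \<open>e = k\<close> for \<open>t_k \<le> r < t_{k+1}\<close>. A tree that is not a star
  has a vertex \<open>v\<close> (a stem) all of whose neighbors except one are leaves; let \<open>R\<close> be the set of
  these leaves, with \<open>t_i \<le> |R| < t_{i+1}\<close>. Playing on disjoint vertex sets in turn, Lister gets
  \<open>e(T) \<ge> i + e(T - R - v)\<close>, and if \<open>|R| + 1 = t_{i+1}\<close> even \<open>e(T) \<ge> i + e(T - R)\<close>. By induction and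
  \<open>t_{i+j+1} = t_{i+1} + t_{j+1} + ij - 1\<close>, a tree on \<open>n\<close> vertices that is not a star satisfies
  \<open>n + ij \<le> t_{e+1}\<close> with \<open>e = e(T) = i + j\<close> and \<open>i, j \<ge> 1\<close>. For \<open>n > t_e\<close> this forces
  \<open>ij \<le> i + j\<close>, so that \<open>i = 1\<close>, \<open>j = 1\<close> or \<open>i = j = 2\<close>; the last case is \<open>n = 11\<close>, and in each
  case what remains of \<open>T\<close> is a star, with the exception \<open>n = 7\<close>. Painter's strategies
  show that the listed trees attain the bound.
\<close>

section \<open>Triangular numbers\<close>

primrec tri :: "nat \<Rightarrow> nat" where
  "tri 0 = 0"
| "tri (Suc k) = Suc k + tri k"

lemma tri_choose: "tri k = (k + 1) choose 2"
  by (induction k) (auto simp: numeral_2_eq_2)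

lemma triangular_iff_tri: "triangular m \<longleftrightarrow> (\<exists>k\<ge>1. m = tri k)"
  by (simp add: triangular_def tri_choose)

text \<open>This identity governs the classification: the thresholds of two parts with excesses
  \<open>x\<close> and \<open>y\<close> add up to \<open>x * y - 1\<close> less than the threshold
  of the joint excess \<open>x + y\<close>. For \<open>x, y\<close> at least 1 with fixed sum, the
  most unbalanced splits lose least.\<close>

lemma tri_add: "tri (Suc (x + y)) + 1 = tri (Suc x) + tri (Suc y) + x * y"
  by (induction y) (auto simp: algebra_simps)

lemma tri_mono: "j \<le> k \<Longrightarrow> tri j \<le> tri k"
  by (induction k) (auto simp: le_Suc_eq)

lemma tri_less_imp_less: "tri j < tri k \<Longrightarrow> j < k"
  using tri_mono[of k j] by linarith

lemma le_tri: "k \<le> tri k"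
  by (cases k) auto

lemma tri_between: obtains k where "tri k \<le> m" "m < tri (Suc k)"
proof -
  have "m < tri (Suc m)" using le_tri[of "Suc m"] by linarith
  then have ex: "\<exists>k. m < tri (Suc k)" by blast
  define k where "k = (LEAST k. m < tri (Suc k))"
  have "m < tri (Suc k)" unfolding k_def using ex by (rule LeastI_ex)
  moreover have "tri k \<le> m"
  proof (cases k)
    case (Suc j)
    then have "\<not> m < tri (Suc j)" unfolding k_def by (intro not_less_Least) simp
    then show ?thesis using Suc by simp
  qed simp
  ultimately show thesis using that by blast
qed

section \<open>The value of the game\<close>

text \<open>The graph stays fixed and a position is just its set of uncolored vertices, so the costs
  of all induced subgraphs are values of one function. For finite \<open>U\<close> the minimum
  exists by \<open>painter_holds_square\<close>.\<close>

definition cost :: "'a pair_pre_digraph \<Rightarrow> 'a set \<Rightarrow> nat" where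
  "cost G U = (LEAST k. painter_holds G U k)"

lemma indep_set_subset: "indep_set G I \<Longrightarrow> J \<subseteq> I \<Longrightarrow> indep_set G J"
  by (auto simp: indep_set_def)

text \<open>\<open>R\<close> may be empty and may omit further leaves at \<open>v\<close>. Adjacency
  is tested only inside \<open>U\<close>, so the condition persists while vertices other than
  \<open>v\<close> are colored and leave \<open>U\<close> and \<open>R\<close>.\<close>

definition pendants :: "'a pair_pre_digraph \<Rightarrow> 'a \<Rightarrow> 'a set \<Rightarrow> 'a set \<Rightarrow> bool" where
  "pendants G v R U \<longleftrightarrow>
    R \<subseteq> U \<and> v \<in> U - R \<and> (\<forall>w\<in>R. \<forall>y\<in>U. (w, y) \<in> parcs G \<longleftrightarrow> y = v)"

context pair_graph
begin

lemma arc_sym: "(u, v) \<in> parcs G \<longleftrightarrow> (v, u) \<in> parcs G"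
  using arcs_symmetric by blast

lemma arc_irrefl: "(u, u) \<notin> parcs G"
  using pair_no_loops by fastforce

lemma painter_holds_iff:
  assumes "finite U"
  shows "painter_holds G U k \<longleftrightarrow> cost G U \<le> k"
proof
  show "cost G U \<le> k" if "painter_holds G U k"
    unfolding cost_def using that by (rule Least_le)
  have "painter_holds G U (cost G U)"
    unfolding cost_def
    using painter_holds_square[OF pair_graph assms] by (rule LeastI)
  then show "painter_holds G U k" if "cost G U \<le> k"
    using that by (rule painter_holds_mono)
qed

lemma cost_empty: "cost G {} = 0"
  using painter_holds_iff[of "{}" 0] painter_holds_square[OF pair_graph, of "{}"] by simp

lemma sum_color_cost_eq: "sum_color_cost G = cost G (pverts G)"
proof -
  from game_has_value[OF pair_graph] obtain v where
    v: "painter_holds G (pverts G) v" "lister_forces G (pverts G) v" by blast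
  have "sum_color_cost G = v"
    unfolding sum_color_cost_def using v game_has_value[OF pair_graph] by (rule_tac the1_equality) auto
  moreover have "cost G (pverts G) = v"
  proof (rule antisym)
    show "cost G (pverts G) \<le> v" using v(1) painter_holds_iff pair_finite_verts by blast
    have "painter_holds G (pverts G) (cost G (pverts G))"
      using painter_holds_iff pair_finite_verts by blast
    then show "v \<le> cost G (pverts G)" using v(2) painter_not_lister by (meson not_le)
  qed
  ultimately show ?thesis by simp
qed

section \<open>Optimal moves and superadditivity\<close>

lemma response:
  assumes "finite U" "M \<subseteq> U"
  shows "\<exists>I\<subseteq>M. indep_set G I \<and> card M + cost G (U - I) \<le> cost G U \<and> (I = {} \<longrightarrow> M = {})"
proof (cases "M = {}")
  case True
  then show ?thesis by (simp add: indep_set_def)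
next
  case False
  have "painter_holds G U (cost G U)" using assms(1) by (simp add: painter_holds_iff)
  then have "card M \<le> cost G U \<and>
      (\<exists>I\<subseteq>M. indep_set G I \<and> painter_holds G (U - I) (cost G U - card M))"
    by cases (use assms(2) False in blast)
  then obtain I where I: "card M \<le> cost G U" "I \<subseteq> M" "indep_set G I"
    "cost G (U - I) \<le> cost G U - card M"
    using assms(1) painter_holds_iff finite_Diff by blast
  moreover have "0 < card M" using False assms finite_subset by (auto simp: card_gt_0_iff)
  ultimately show ?thesis by (intro exI[of _ I]) auto
qed

text \<open>An optimal mark of Lister: if every mark had an answer keeping the total below
  \<open>cost G U\<close>, Painter could hold the game to one point less.\<close>

lemma mark:
  assumes "finite U" "U \<noteq> {}"
  shows "\<exists>M\<subseteq>U. M \<noteq> {} \<and> (\<forall>I\<subseteq>M. indep_set G I \<longrightarrow> cost G U \<le> card M + cost G (U - I))"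
proof (rule ccontr)
  assume no: "\<not> ?thesis"
  have I: "\<exists>I\<subseteq>M. indep_set G I \<and> card M + cost G (U - I) < cost G U"
    if "M \<subseteq> U" "M \<noteq> {}" for M using no that by (meson not_le)
  have "0 < cost G U" using I[of U] assms(2) by fastforce
  have "painter_holds G U (cost G U - 1)"
  proof (rule painter_holds.respond)
    fix M assume M: "M \<subseteq> U" "M \<noteq> {}"
    from I[OF this] obtain I where "I \<subseteq> M" "indep_set G I" "card M + cost G (U - I) < cost G U"
      by blast
    moreover have "finite (U - I)" using assms(1) by simp
    ultimately show "card M \<le> cost G U - 1 \<and>
        (\<exists>I\<subseteq>M. indep_set G I \<and> painter_holds G (U - I) (cost G U - 1 - card M))"
      using painter_holds_iff by (intro conjI exI[of _ I]) auto
  qed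
  then show False using assms(1) \<open>0 < cost G U\<close> by (simp add: painter_holds_iff)
qed

text \<open>Lister plays optimally on \<open>A\<close> and turns to \<open>B\<close> once
  \<open>A\<close> is colored. Arcs between the sets are harmless, since Painter's answers stay
  inside the mark.\<close>

lemma cost_superadditive:
  assumes "finite A" "finite B" "A \<inter> B = {}"
  shows "cost G A + cost G B \<le> cost G (A \<union> B)"
  using assms
proof (induction "card A" arbitrary: A rule: less_induct)
  case less
  show ?case
  proof (cases "A = {}")
    case True
    then show ?thesis by (simp add: cost_empty)
  next
    case False
    obtain M where M: "M \<subseteq> A" "M \<noteq> {}"
      and opt: "\<And>I. I \<subseteq> M \<Longrightarrow> indep_set G I \<Longrightarrow> cost G A \<le> card M + cost G (A - I)"
      using mark[OF less.prems(1) False] by blast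
    obtain I where I: "I \<subseteq> M" "indep_set G I"
      "card M + cost G (A \<union> B - I) \<le> cost G (A \<union> B)" "I \<noteq> {}"
      using response[of "A \<union> B" M] M less.prems(1,2) by (metis finite_Un le_supI1)
    have "cost G (A - I) + cost G B \<le> cost G ((A - I) \<union> B)"
      using I M less.prems by (intro less.hyps psubset_card_mono) auto
    moreover have "A \<union> B - I = (A - I) \<union> B" using I M less.prems by blast
    ultimately show ?thesis using opt[OF I(1,2)] I(3) by simp
  qed
qed

lemma cost_mono: "finite B \<Longrightarrow> A \<subseteq> B \<Longrightarrow> cost G A \<le> cost G B"
  using cost_superadditive[of A "B - A"] finite_subset[of A B]
  by (simp add: Un_absorb1)

lemma card_le_cost:
  assumes "finite U"
  shows "card U \<le> cost G U"
  using response[OF assms subset_refl] add_leD1 by blast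

section \<open>Painter's strategies: upper bounds\<close>

text \<open>Painter answers optimally on \<open>U - R\<close> and also colors every marked vertex of
  \<open>R\<close>, so that each of these is marked only once.\<close>

lemma cost_isolated:
  assumes "finite U" "R \<subseteq> U" "\<And>w y. w \<in> R \<Longrightarrow> y \<in> U \<Longrightarrow> (w, y) \<notin> parcs G"
  shows "cost G U \<le> cost G (U - R) + card R"
  using assms
proof (induction "card U" arbitrary: U R rule: less_induct)
  case less
  note fin = less.prems(1)
  show ?case
  proof (cases "U = {}")
    case True
    then show ?thesis using less.prems by simp
  next
    case False
    obtain M where M: "M \<subseteq> U" "M \<noteq> {}"
      and opt: "\<And>I. I \<subseteq> M \<Longrightarrow> indep_set G I \<Longrightarrow> cost G U \<le> card M + cost G (U - I)"
      using mark[OF fin False] by blast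
    obtain J where J: "J \<subseteq> M - R" "indep_set G J"
      "card (M - R) + cost G ((U - R) - J) \<le> cost G (U - R)" "J = {} \<longrightarrow> M - R = {}"
      using response[OF finite_Diff[OF fin] Diff_mono[OF M(1) subset_refl], of R] by blast
    define I where "I = J \<union> (M \<inter> R)"
    have "indep_set G I"
      using J(1,2) M less.prems(2,3) arc_sym unfolding I_def indep_set_def by blast
    moreover have "I \<subseteq> M" using J I_def by blast
    moreover have ne: "I \<noteq> {}" using J(4) M I_def by blast
    ultimately have "cost G U \<le> card M + cost G (U - I)" using opt by blast
    also have "cost G (U - I) \<le> cost G ((U - I) - (R - M)) + card (R - M)"
    proof (rule less.hyps)
      show "card (U - I) < card U" using ne \<open>I \<subseteq> M\<close> M fin by (intro psubset_card_mono) auto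
      show "R - M \<subseteq> U - I" using less.prems(2) J(1) I_def by blast
    qed (use less.prems in auto)
    also have "(U - I) - (R - M) = (U - R) - J" using I_def J(1) by blast
    finally have "cost G U \<le> card M + (cost G (U - R - J) + card (R - M))" by simp
    moreover have "card M = card (M - R) + card (M \<inter> R)"
      using M(1) fin finite_subset by (metis card_Diff_subset_Int card_mono add_diff_cancel_left' finite_Int inf_le1 le_add_diff_inverse2)
    moreover have "card R = card (R - M) + card (M \<inter> R)"
      using less.prems(2) fin finite_subset by (metis card_Diff_subset_Int card_mono finite_Int inf_commute inf_le1 le_add_diff_inverse2)
    ultimately show ?thesis using J(3) by linarith
  qed
qed

text \<open>Painter consults an optimal answer \<open>J\<close> on \<open>U - R\<close>. If
  \<open>J\<close> avoids \<open>v\<close>, all marked pendants are colored along with it. If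
  \<open>J\<close> contains \<open>v\<close> and at most \<open>k\<close> pendants are marked, she
  plays \<open>J\<close>; these marks are wasted, but all pendants become isolated. If more are
  marked, she colors them and answers on \<open>U - R\<close> as if \<open>v\<close> were
  unmarked.\<close>

lemma cost_remove_pendants_le:
  assumes "finite U" "pendants G v R U" "card R < tri (Suc k)"
  shows "cost G U \<le> cost G (U - R) + card R + k"
  using assms
proof (induction "card U" arbitrary: U R k rule: less_induct)
  case less
  note fin = less.prems(1)
  have R: "R \<subseteq> U" "v \<in> U" "v \<notin> R" and nbr: "\<And>w y. w \<in> R \<Longrightarrow> y \<in> U \<Longrightarrow> (w, y) \<in> parcs G \<longleftrightarrow> y = v"
    using less.prems(2) by (auto simp: pendants_def)
  have finR: "finite R" using R fin finite_subset by blast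
  obtain M where M: "M \<subseteq> U" "M \<noteq> {}"
    and opt: "\<And>I. I \<subseteq> M \<Longrightarrow> indep_set G I \<Longrightarrow> cost G U \<le> card M + cost G (U - I)"
    using mark[OF fin] R(2) by blast
  have finM: "finite M" using M fin finite_subset by blast
  have cardM: "card M = card (M - R) + card (M \<inter> R)" and cardR: "card R = card (R - M) + card (M \<inter> R)"
    using card_Int_Diff[OF finM, of R] card_Int_Diff[OF finR, of M] by (simp_all add: Int_commute)
  have indep: "indep_set G (J \<union> (M \<inter> R))" if "indep_set G J" "J \<subseteq> U - R - {v}" for J
    using that R nbr arc_sym unfolding indep_set_def by blast
  have leave: "cost G U \<le> card M + cost G (U - R - J) + card (R - M) + j"
    if J: "indep_set G J" "J \<subseteq> M - R - {v}" "J \<union> (M \<inter> R) \<noteq> {}" and j: "card (R - M) < tri (Suc j)" for J j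
  proof -
    let ?I = "J \<union> (M \<inter> R)"
    have I: "?I \<subseteq> M" using J(2) by blast
    have "cost G (U - ?I) \<le> cost G (U - ?I - (R - M)) + card (R - M) + j"
    proof (rule less.hyps)
      show "card (U - ?I) < card U" using I M J(3) fin by (intro psubset_card_mono) auto
      show "pendants G v (R - M) (U - ?I)" using R nbr J(2) unfolding pendants_def by blast
    qed (use fin j in auto)
    moreover have "U - ?I - (R - M) = U - R - J" using J(2) R by blast
    moreover have "cost G U \<le> card M + cost G (U - ?I)"
      using indep[OF J(1)] J(2) M I by (intro opt) auto
    ultimately show ?thesis by simp
  qed
  obtain J where J: "J \<subseteq> M - R" "indep_set G J"
    "card (M - R) + cost G (U - R - J) \<le> cost G (U - R)" "J = {} \<longrightarrow> M - R = {}"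
    using response[OF finite_Diff[OF fin] Diff_mono[OF M(1) subset_refl], of R] by blast
  show ?case
  proof (cases "v \<in> J")
    case False
    have "cost G U \<le> card M + cost G (U - R - J) + card (R - M) + k"
      using J M False less.prems(3) cardR by (intro leave) auto
    then show ?thesis using J(3) cardM cardR by simp
  next
    case True
    show ?thesis
    proof (cases "card (M \<inter> R) \<le> k")
      case True
      have "cost G U \<le> card M + cost G (U - J)" using J by (intro opt) auto
      also have "cost G (U - J) \<le> cost G (U - J - R) + card R"
        using fin R J nbr \<open>v \<in> J\<close> by (intro cost_isolated) blast+
      also have "U - J - R = U - R - J" by blast
      finally show ?thesis using J(3) True cardM by simp
    next
      case False
      then obtain j where k: "k = Suc j"
        using less.prems(3) cardR by (cases k) auto
      obtain L where L: "L \<subseteq> M - R - {v}" "indep_set G L"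
        "card (M - R - {v}) + cost G (U - R - L) \<le> cost G (U - R)"
        using response[of "U - R" "M - R - {v}"] M(1) fin by blast
      \<comment> \<open>The mark on \<open>v\<close> wastes one point. More than \<open>k\<close> of
        fewer than \<open>tri (Suc k)\<close> pendants disappear, so fewer than \<open>tri k\<close>
        remain and the overhead drops from \<open>k\<close> to \<open>j\<close>.\<close>
      have "cost G U \<le> card M + cost G (U - R - L) + card (R - M) + j"
        using L False less.prems(3) cardR k by (intro leave) auto
      moreover have "card (M - R) = Suc (card (M - R - {v}))"
        using True J(1) finM by (intro card.remove) auto
      ultimately show ?thesis using L(3) cardM cardR k by simp
    qed
  qed
qed

text \<open>Now \<open>v\<close> is removed together with its pendants. As \<open>x\<close> is its
  only possible neighbor outside \<open>R\<close>, Painter combines a move on the rest with coloring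
  \<open>v\<close> whenever that move avoids \<open>x\<close>. The condition on \<open>x\<close> is
  an implication so that it survives the coloring of \<open>x\<close>.\<close>

lemma cost_remove_stem_le:
  assumes "finite U" "pendants G v R U" "v \<noteq> x" "\<And>y. y \<in> U - R \<Longrightarrow> (v, y) \<in> parcs G \<Longrightarrow> y = x"
    and "Suc (card R) < tri (Suc k)"
  shows "cost G U \<le> cost G (U - insert v R) + card R + 1 + k"
  using assms
proof (induction "card U" arbitrary: U R k rule: less_induct)
  case less
  note fin = less.prems(1)
  have R: "R \<subseteq> U" "v \<in> U" "v \<notin> R" and nbr: "\<And>w y. w \<in> R \<Longrightarrow> y \<in> U \<Longrightarrow> (w, y) \<in> parcs G \<longleftrightarrow> y = v"
    using less.prems(2) by (auto simp: pendants_def)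
  have finR: "finite R" using R fin finite_subset by blast
  define A where "A = U - insert v R"
  have nbrv: "\<And>y. y \<in> A \<Longrightarrow> (v, y) \<in> parcs G \<Longrightarrow> y = x" using less.prems(4) A_def by blast
  have finA: "finite A" using A_def fin by blast
  obtain M where M: "M \<subseteq> U" "M \<noteq> {}"
    and opt: "\<And>I. I \<subseteq> M \<Longrightarrow> indep_set G I \<Longrightarrow> cost G U \<le> card M + cost G (U - I)"
    using mark[OF fin] R(2) by blast
  have finM: "finite M" using M fin finite_subset by blast
  have cardM: "card M = card (M \<inter> A) + card (M \<inter> R) + card (M \<inter> {v})"
  proof -
    have "M = M \<inter> A \<union> M \<inter> R \<union> M \<inter> {v}" using M A_def by blast
    moreover have "card (M \<inter> A \<union> M \<inter> R \<union> M \<inter> {v}) = card (M \<inter> A \<union> M \<inter> R) + card (M \<inter> {v})"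
      using finM R A_def by (intro card_Un_disjoint) auto
    moreover have "card (M \<inter> A \<union> M \<inter> R) = card (M \<inter> A) + card (M \<inter> R)"
      using finM A_def by (intro card_Un_disjoint) auto
    ultimately show ?thesis by simp
  qed
  have cardR: "card R = card (R - M) + card (M \<inter> R)"
    using card_Int_Diff[OF finR, of M] by (simp add: Int_commute)
  have indep: "indep_set G (J \<union> (M \<inter> R))" if "indep_set G J" "J \<subseteq> A" for J
    using that R nbr arc_sym unfolding indep_set_def A_def by blast
  have leave: "cost G U \<le> card M + cost G (A - J) + card (R - M) + 1 + j"
    if J: "indep_set G J" "J \<subseteq> M \<inter> A" "J \<union> (M \<inter> R) \<noteq> {}" and j: "Suc (card (R - M)) < tri (Suc j)" for J j
  proof -
    let ?I = "J \<union> (M \<inter> R)"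
    have I: "?I \<subseteq> M" using J(2) by blast
    have "cost G (U - ?I) \<le> cost G (U - ?I - insert v (R - M)) + card (R - M) + 1 + j"
    proof (rule less.hyps)
      show "card (U - ?I) < card U" using I M J(3) fin by (intro psubset_card_mono) auto
      show "pendants G v (R - M) (U - ?I)" using R nbr J(2) unfolding pendants_def A_def by blast
      show "y = x" if "y \<in> U - ?I - (R - M)" "(v, y) \<in> parcs G" for y
        using that less.prems(4) by blast
    qed (use fin j less.prems(3) in auto)
    moreover have "U - ?I - insert v (R - M) = A - J" using J(2) R A_def by blast
    moreover have "cost G U \<le> card M + cost G (U - ?I)"
      using indep[OF J(1)] J(2) I by (intro opt) auto
    ultimately show ?thesis by simp
  qed
  have color: "cost G U \<le> card M + cost G (A - J) + card R"
    if "v \<in> M" and J: "indep_set G J" "J \<subseteq> M \<inter> A - {x}" for J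
  proof -
    have "indep_set G (insert v J)"
      using J nbrv arc_sym arc_irrefl unfolding indep_set_def by blast
    then have "cost G U \<le> card M + cost G (U - insert v J)" using J that(1) by (intro opt) auto
    also have "cost G (U - insert v J) \<le> cost G (U - insert v J - R) + card R"
      using fin R J nbr unfolding A_def by (intro cost_isolated) blast+
    also have "U - insert v J - R = A - J" using A_def by blast
    finally show ?thesis by simp
  qed
  obtain J where J: "J \<subseteq> M \<inter> A" "indep_set G J"
    "card (M \<inter> A) + cost G (A - J) \<le> cost G A" "J = {} \<longrightarrow> M \<inter> A = {}"
    using response[OF finA, of "M \<inter> A"] by blast
  obtain j where k: "k = Suc j" using less.prems(5) by (cases k) auto
  have "cost G U \<le> cost G A + card R + 1 + k"
  proof (cases "v \<in> M")
    case False
    have "M \<inter> A \<union> M \<inter> R \<noteq> {}" using False M A_def by blast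
    then have "cost G U \<le> card M + cost G (A - J) + card (R - M) + 1 + k"
      using J M False less.prems(5) cardR by (intro leave) auto
    then show ?thesis using J(3) cardM cardR False by simp
  next
    case v: True
    then have cardM': "card M = card (M \<inter> A) + card (M \<inter> R) + 1" using cardM by simp
    consider "card (M \<inter> R) < k" | "k \<le> card (M \<inter> R)" "x \<in> J"
      | "card (M \<inter> R) = k" "x \<notin> J" | "k < card (M \<inter> R)" by linarith
    then show ?thesis
    proof cases
      \<comment> \<open>Few marked pendants: Painter colors \<open>v\<close> and treats
        \<open>x\<close> as unmarked. The point lost on \<open>x\<close> and the fewer than
        \<open>k\<close> wasted pendant marks sum to at most \<open>k\<close>.\<close>
      case 1
      obtain L where L: "L \<subseteq> M \<inter> A - {x}" "indep_set G L"
        "card (M \<inter> A - {x}) + cost G (A - L) \<le> cost G A"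
        using response[OF finA, of "M \<inter> A - {x}"] by blast
      have "card (M \<inter> A) \<le> card (M \<inter> A - {x}) + 1"
        by (simp add: card_Diff_singleton_if, linarith)
      then show ?thesis using color[OF v L(2,1)] L(3) 1 cardM' by linarith
    next
      \<comment> \<open>Coloring \<open>x\<close> cuts \<open>v\<close> off from the rest, so a star
        around \<open>v\<close> remains, to which the pendant bound with \<open>j\<close> applies.
        The drop from \<open>k\<close> to \<open>j\<close> pays for the wasted mark on
        \<open>v\<close>.\<close>
      case 2
      let ?I = "J \<union> (M \<inter> R)"
      have "cost G U \<le> card M + cost G (U - ?I)"
        using indep[OF J(2)] J(1) by (intro opt) auto
      also have "cost G (U - ?I) \<le> cost G (U - ?I - (R - M)) + card (R - M) + j"
      proof (rule cost_remove_pendants_le)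
        show "pendants G v (R - M) (U - ?I)" using R nbr J(1) unfolding pendants_def A_def by blast
        show "card (R - M) < tri (Suc j)" using 2 less.prems(5) k cardR by simp
      qed (use fin in auto)
      also have "U - ?I - (R - M) = insert v (A - J)" using J(1) R A_def by blast
      also have "cost G (insert v (A - J)) \<le> cost G (insert v (A - J) - {v}) + card {v}"
        using finA nbrv 2 arc_irrefl by (intro cost_isolated) auto
      also have "insert v (A - J) - {v} = A - J" using A_def by blast
      finally show ?thesis using J(3) cardM' cardR k by simp
    next
      \<comment> \<open>As the answer avoids \<open>x\<close>, \<open>v\<close> can be added to it;
        exactly \<open>k\<close> pendant marks are wasted.\<close>
      case 3
      then have "cost G U \<le> card M + cost G (A - J) + card R"
        using J by (intro color v) auto
      then show ?thesis using J(3) cardM' 3 by simp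
    next
      \<comment> \<open>So many pendants are colored that \<open>j\<close> suffices for the rest,
        which pays for the wasted mark on \<open>v\<close>.\<close>
      case 4
      have "cost G U \<le> card M + cost G (A - J) + card (R - M) + 1 + j"
        using 4 J less.prems(5) cardR k by (intro leave) auto
      then show ?thesis using J(3) cardM' cardR k by simp
    qed
  qed
  then show ?case unfolding A_def .
qed

section \<open>Lister's strategies: lower bounds\<close>

text \<open>Lister marks \<open>v\<close> and \<open>Suc k\<close> leaves. Coloring \<open>v\<close>
  wastes all these leaf marks. Otherwise the mark on \<open>v\<close> is wasted, and at least
  \<open>tri k\<close> unmarked leaves remain for the induction; this is where triangular numbers
  come from.\<close>

lemma cost_star_ge:
  assumes "finite R" "v \<notin> R" "\<And>w. w \<in> R \<Longrightarrow> (v, w) \<in> parcs G" "tri k \<le> card R"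
  shows "card R + 1 + k \<le> cost G (insert v R)"
  using assms
proof (induction k arbitrary: R)
  case 0
  then show ?case using card_le_cost[of "insert v R"] by simp
next
  case (Suc k)
  have "Suc k \<le> card R" using Suc.prems(4) by simp
  then obtain N where N: "N \<subseteq> R" "card N = Suc k" by (metis obtain_subset_with_card_n)
  have finN: "finite N" using N(1) Suc.prems(1) finite_subset by blast
  let ?M = "insert v N"
  have cardM: "card ?M = Suc k + 1" using N finN Suc.prems(2) by (subst card_insert_disjoint) auto
  obtain I where I: "I \<subseteq> ?M" "indep_set G I" "card ?M + cost G (insert v R - I) \<le> cost G (insert v R)"
    using response[of "insert v R" ?M] insert_mono[OF N(1)] Suc.prems(1) by blast
  show ?case
  proof (cases "v \<in> I")
    case True
    then have "I = {v}" using I(1,2) N(1) Suc.prems(3) unfolding indep_set_def by blast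
    then have "insert v R - I = R" using Suc.prems(2) by blast
    then show ?thesis using I(3) card_le_cost[OF Suc.prems(1)] cardM by simp
  next
    case False
    then have IN: "I \<subseteq> N" using I(1) by blast
    have "card (R - N) + 1 + k + card (N - I) \<le> cost G (insert v (R - N)) + cost G (N - I)"
    proof (rule add_mono)
      show "card (R - N) + 1 + k \<le> cost G (insert v (R - N))"
        using Suc.prems N finN by (intro Suc.IH) (auto simp: card_Diff_subset)
      show "card (N - I) \<le> cost G (N - I)" using finN by (intro card_le_cost) auto
    qed
    also have "\<dots> \<le> cost G (insert v (R - N) \<union> (N - I))"
      using Suc.prems N finN by (intro cost_superadditive) auto
    also have "insert v (R - N) \<union> (N - I) = insert v R - I" using IN N(1) Suc.prems(2) by blast
    finally have "card (R - N) + 1 + k + card (N - I) \<le> cost G (insert v R - I)" .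
    moreover have "card (R - N) = card R - Suc k" using N finN by (simp add: card_Diff_subset)
    ultimately show ?thesis using I(3) cardM \<open>Suc k \<le> card R\<close> by simp
  qed
qed

text \<open>
  Lister plays optimally on \<open>U - R\<close>; when this strategy marks \<open>v\<close>, he adds \<open>k\<close> vertices of \<open>R\<close> to
  the mark. If \<open>v\<close> survives that round, he plays the star of \<open>v\<close> separately from then on.
\<close>

lemma cost_remove_pendants_ge:
  assumes "finite U" "pendants G v R U" "v \<noteq> x" "\<And>y. y \<in> U - R \<Longrightarrow> (v, y) \<in> parcs G \<Longrightarrow> y = x"
    and "Suc (card R) = tri (Suc k)"
  shows "cost G (U - R) + card R + k \<le> cost G U"
  using assms
proof (induction "card U" arbitrary: U rule: less_induct)
  case less
  note fin = less.prems(1)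
  have R: "R \<subseteq> U" "v \<in> U" "v \<notin> R" and nbr: "\<And>w y. w \<in> R \<Longrightarrow> y \<in> U \<Longrightarrow> (w, y) \<in> parcs G \<longleftrightarrow> y = v"
    using less.prems(2) by (auto simp: pendants_def)
  have finR: "finite R" using R fin finite_subset by blast
  have vR: "(v, w) \<in> parcs G" if "w \<in> R" for w using nbr[OF that R(2)] arc_sym by blast
  define B where "B = U - R"
  define A where "A = B - {v}"
  have finB: "finite B" "finite A" and vB: "v \<in> B" using B_def A_def fin R by auto
  have nbrv: "\<And>y. y \<in> B \<Longrightarrow> (v, y) \<in> parcs G \<Longrightarrow> y = x" using less.prems(4) B_def by blast
  have card_R: "card R = tri k + k" using less.prems(5) by simp
  obtain M where M: "M \<subseteq> B" "M \<noteq> {}"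
    and opt: "\<And>I. I \<subseteq> M \<Longrightarrow> indep_set G I \<Longrightarrow> cost G B \<le> card M + cost G (B - I)"
    using mark[of B] finB(1) vB by blast
  have finM: "finite M" using M finB finite_subset by blast
  have "cost G B + card R + k \<le> cost G U"
  proof (cases "v \<in> M")
    case False
    obtain I where I: "I \<subseteq> M" "indep_set G I" "card M + cost G (U - I) \<le> cost G U" "I \<noteq> {}"
      using response[OF fin, of M] M B_def by blast
    have "cost G (U - I - R) + card R + k \<le> cost G (U - I)"
    proof (rule less.hyps)
      show "card (U - I) < card U" using I M B_def fin by (intro psubset_card_mono) auto
      show "pendants G v R (U - I)"
        using R nbr I(1) False M B_def unfolding pendants_def by blast
    qed (use less.prems in auto)
    moreover have "U - I - R = B - I" using B_def by blast
    ultimately show ?thesis using I(3) opt[OF I(1,2)] by simp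
  next
    case v: True
    define M' where "M' = M - {v}"
    have M': "card M = Suc (card M')" "M' \<subseteq> A"
      using card.remove[OF finM v] M M'_def A_def by auto
    \<comment> \<open>Without pendants and with \<open>k = 1\<close>, the stem bound shows that
      \<open>v\<close> adds at most two to the cost of \<open>A\<close>. If it adds at most one,
      separate play on \<open>A\<close> and on the star suffices.\<close>
    have "pendants G v {} B" using vB by (simp add: pendants_def)
    then have "cost G B \<le> cost G (B - insert v {}) + card ({} :: 'a set) + 1 + 1"
      using finB less.prems(3) nbrv
      by (intro cost_remove_stem_le[where x = x]) auto
    then have AB: "cost G B \<le> cost G A + 2" by (simp add: A_def)
    have star: "card R + 1 + k \<le> cost G (insert v R)"
      using finR R vR card_R by (intro cost_star_ge) auto
    show ?thesis
    proof (cases "cost G B \<le> cost G A + 1")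
      case True
      have "cost G A + cost G (insert v R) \<le> cost G (A \<union> insert v R)"
        using finB finR A_def B_def by (intro cost_superadditive) auto
      moreover have "A \<union> insert v R = U" using A_def B_def R by blast
      ultimately show ?thesis using True star by simp
    next
      case False
      \<comment> \<open>With \<open>k\<close> pendants marked, \<open>tri k\<close> stay unmarked,
        just enough for the star bound with \<open>k\<close>.\<close>
      obtain N where N: "N \<subseteq> R" "card N = k"
        using obtain_subset_with_card_n[of k R] card_R by auto
      have finN: "finite N" using N(1) finR finite_subset by blast
      have cardMN: "card (M \<union> N) = card M + k"
        using finM finN N M B_def by (subst card_Un_disjoint) auto
      obtain I where I: "I \<subseteq> M \<union> N" "indep_set G I" "card (M \<union> N) + cost G (U - I) \<le> cost G U"
        using response[OF fin, of "M \<union> N"] M N B_def R(1) by blast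
      show ?thesis
      proof (cases "v \<in> I")
        case True
        \<comment> \<open>The answer contains \<open>v\<close> and hence no pendant, so all
          \<open>k\<close> additional marks are wasted.\<close>
        then have IM: "I \<subseteq> M" using I(1,2) N(1) vR unfolding indep_set_def by blast
        have "cost G (B - I) + card R \<le> cost G (B - I) + cost G R"
          using card_le_cost[OF finR] by simp
        also have "\<dots> \<le> cost G (B - I \<union> R)"
          using finB finR B_def by (intro cost_superadditive) auto
        also have "B - I \<union> R = U - I" using IM M B_def R by blast
        finally show ?thesis using opt[OF IM I(2)] I(3) cardMN by simp
      next
        case vI: False
        define J where "J = I \<inter> M"
        have J: "J \<subseteq> M'" "indep_set G J"
          using vI I(2) M'_def J_def by (auto intro: indep_set_subset)
        have "card (R - N) + 1 + k \<le> cost G (insert v (R - N))"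
          using finR R vR card_R N finN by (intro cost_star_ge) (auto simp: card_Diff_subset)
        then have "cost G (A - J) + (tri k + 1 + k) \<le> cost G (A - J) + cost G (insert v (R - N))"
          using card_R N finN by (simp add: card_Diff_subset)
        also have "\<dots> \<le> cost G (A - J \<union> insert v (R - N))"
          using finB finR A_def B_def by (intro cost_superadditive) auto
        also have "\<dots> \<le> cost G (U - I)"
        proof (rule cost_mono)
          show "A - J \<union> insert v (R - N) \<subseteq> U - I"
            using I(1) vI J_def A_def B_def R M N by blast
        qed (use fin in auto)
        finally have rest: "cost G (A - J) + (tri k + 1 + k) \<le> cost G (U - I)" .
        \<comment> \<open>Optimality of \<open>M\<close> on \<open>B\<close> carries over to
          \<open>M'\<close> on \<open>A\<close>: if \<open>x\<close> is colored, \<open>v\<close> is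
          left isolated and costs one more point; otherwise \<open>v\<close> could have been colored
          together with \<open>J\<close>. Both are compared with \<open>cost G B\<close>, which here
          is \<open>cost G A + 2\<close>.\<close>
        have "cost G A \<le> card M' + cost G (A - J)"
        proof (cases "x \<in> J")
          case True
          have "cost G B \<le> card M + cost G (B - J)" using J M'_def by (intro opt) auto
          also have "cost G (B - J) \<le> cost G (B - J - {v}) + card {v}"
            using finB nbrv True J M'_def vB arc_irrefl by (intro cost_isolated) auto
          also have "B - J - {v} = A - J" using A_def by blast
          finally show ?thesis using False M'(1) by simp
        next
          case False
          have "indep_set G (insert v J)"
            using J M' M nbrv arc_sym arc_irrefl False unfolding indep_set_def A_def by blast
          then have "cost G B \<le> card M + cost G (B - insert v J)"
            using J M'_def v by (intro opt) auto
          also have "B - insert v J = A - J" using A_def by blast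
          finally show ?thesis using M'(1) \<open>\<not> cost G B \<le> cost G A + 1\<close> by simp
        qed
        then show ?thesis using rest I(3) cardMN M'(1) AB card_R by simp
      qed
    qed
  qed
  then show ?case unfolding B_def .
qed

end

section \<open>Trees and stems\<close>

text \<open>
  \<open>p\<close> and \<open>d\<close> are the parent map and the depth with respect to the root \<open>z\<close>; the values of \<open>p z\<close>
  and \<open>d z\<close> are irrelevant.
\<close>

definition rooted :: "'a pair_pre_digraph \<Rightarrow> 'a set \<Rightarrow> 'a \<Rightarrow> ('a \<Rightarrow> 'a) \<Rightarrow> ('a \<Rightarrow> nat) \<Rightarrow> bool" where
  "rooted G U z p d \<longleftrightarrow> finite U \<and> z \<in> U
    \<and> (\<forall>w\<in>U - {z}. p w \<in> U \<and> d w = Suc (d (p w)))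
    \<and> (\<forall>a\<in>U. \<forall>b\<in>U. (a, b) \<in> parcs G \<longleftrightarrow> a \<noteq> z \<and> b = p a \<or> b \<noteq> z \<and> a = p b)"

definition tree_on :: "'a pair_pre_digraph \<Rightarrow> 'a set \<Rightarrow> bool" where
  "tree_on G U \<longleftrightarrow> (\<exists>z p d. rooted G U z p d)"

definition star :: "'a pair_pre_digraph \<Rightarrow> 'a \<Rightarrow> 'a set \<Rightarrow> bool" where
  "star G c U \<longleftrightarrow> c \<in> U \<and> (\<forall>a\<in>U. \<forall>b\<in>U. (a, b) \<in> parcs G \<longleftrightarrow> (a = c) \<noteq> (b = c))"

definition stem :: "'a pair_pre_digraph \<Rightarrow> 'a \<Rightarrow> 'a \<Rightarrow> 'a set \<Rightarrow> 'a set \<Rightarrow> bool" where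
  "stem G v x R U \<longleftrightarrow> pendants G v R U \<and> R \<noteq> {} \<and> x \<in> U - insert v R
    \<and> (\<forall>y\<in>U - R. (v, y) \<in> parcs G \<longleftrightarrow> y = x)"

lemma rooted_subset:
  assumes "rooted G U z p d" "W \<subseteq> U" "z \<in> W" "\<And>w. w \<in> W - {z} \<Longrightarrow> p w \<in> W"
  shows "rooted G W z p d"
  using assms finite_subset unfolding rooted_def by blast

lemma tree_on_finite: "tree_on G U \<Longrightarrow> finite U"
  by (auto simp: tree_on_def rooted_def)

lemma rooted_depth_ge:
  assumes "rooted G U z p d"
  shows "w \<in> U \<Longrightarrow> d z \<le> d w"
proof (induction "d w" arbitrary: w rule: less_induct)
  case less
  show ?case
  proof (cases "w = z")
    case False
    then have "p w \<in> U" "d w = Suc (d (p w))" using assms less.prems by (auto simp: rooted_def)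
    then show ?thesis using less.hyps[of "p w"] by simp
  qed simp
qed

context pair_graph
begin

lemma tree_decomposition:
  assumes "tree_on G U"
  shows "(\<exists>c. star G c U) \<or> (\<exists>v x R. stem G v x R U
    \<and> tree_on G (U - R) \<and> tree_on G (U - insert v R) \<and> 2 \<le> card (U - insert v R))"
proof -
  obtain z p d where rt: "rooted G U z p d" using assms unfolding tree_on_def by blast
  then have fin: "finite U" and z: "z \<in> U"
    and par: "\<And>w. w \<in> U \<Longrightarrow> w \<noteq> z \<Longrightarrow> p w \<in> U" "\<And>w. w \<in> U \<Longrightarrow> w \<noteq> z \<Longrightarrow> d w = Suc (d (p w))"
    and arc: "\<And>a b. a \<in> U \<Longrightarrow> b \<in> U \<Longrightarrow> (a, b) \<in> parcs G \<longleftrightarrow> a \<noteq> z \<and> b = p a \<or> b \<noteq> z \<and> a = p b"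
    unfolding rooted_def by simp_all
  show ?thesis
  proof (cases "U = {z}")
    case True
    then have "star G z U" using arc_irrefl by (simp add: star_def)
    then show ?thesis by blast
  next
    case False
    then have ne: "U - {z} \<noteq> {}" using z by blast
    \<comment> \<open>The parent \<open>v\<close> of a deepest vertex \<open>w\<close> is a stem, unless it is the root.\<close>
    have "Max (d ` (U - {z})) \<in> d ` (U - {z})" using ne fin by (intro Max_in) auto
    then obtain w where w: "w \<in> U - {z}" "Max (d ` (U - {z})) = d w" by (rule imageE)
    have max: "d y \<le> d w" if "y \<in> U - {z}" for y
      unfolding w(2)[symmetric] using that fin by (intro Max_ge) auto
    define v where "v = p w"
    have v: "v \<in> U" "d w = Suc (d v)" using par w v_def by auto
    show ?thesis
    proof (cases "v = z")
      case True
      \<comment> \<open>The deepest level lies directly below the root, so a vertex with another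
        parent would be too deep.\<close>
      have "p y = z" if y: "y \<in> U" "y \<noteq> z" for y
      proof (rule ccontr)
        assume "p y \<noteq> z"
        then have "d y = Suc (Suc (d (p (p y))))" "p (p y) \<in> U" using par y by auto
        then show False
          using rooted_depth_ge[OF rt, of "p (p y)"] max[of y] y v True by simp
      qed
      then have "star G z U" using arc z unfolding star_def by metis
      then show ?thesis by blast
    next
      case vz: False
      define x where "x = p v"
      define R where "R = {y \<in> U - {z}. p y = v}"
      have x: "x \<in> U" "d v = Suc (d x)" using par v vz x_def by auto
      have dR: "d y = d w" if "y \<in> R" for y using that par v R_def by auto
      \<comment> \<open>The vertices of \<open>R\<close> are on the deepest level and thus have no
        children.\<close>
      have nochild: "p b \<noteq> y" if "y \<in> R" "b \<in> U" "b \<noteq> z" for b y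
        using that(2,3) dR[OF that(1)] par(2)[of b] max[of b] by auto
      have vR: "v \<notin> R" "x \<notin> R" "x \<noteq> v" using dR[of v] dR[of x] v x by auto
      have "(y, b) \<in> parcs G \<longleftrightarrow> b = v" if "y \<in> R" "b \<in> U" for y b
      proof -
        have "(y, b) \<in> parcs G \<longleftrightarrow> y \<noteq> z \<and> b = p y \<or> b \<noteq> z \<and> y = p b"
          using that R_def by (intro arc) auto
        then show ?thesis using that nochild R_def by blast
      qed
      then have pend: "pendants G v R U" using vR v R_def unfolding pendants_def by blast
      moreover have "R \<noteq> {}" using w v_def R_def by blast
      moreover have "(v, y) \<in> parcs G \<longleftrightarrow> y = x" if "y \<in> U - R" for y
        using that arc[OF v(1), of y] vz R_def x_def by blast
      ultimately have stem: "stem G v x R U" using x vR unfolding stem_def by blast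
      \<comment> \<open>Removing the childless set \<open>R\<close>, or \<open>R\<close> with its
        common parent \<open>v\<close>, leaves a set that contains the root and is closed under
        parents.\<close>
      have "tree_on G (U - R)"
        unfolding tree_on_def
        using rooted_subset[OF rt Diff_subset, of R] par(1) z nochild R_def by blast
      moreover have tree: "tree_on G (U - insert v R)"
        unfolding tree_on_def
        using rooted_subset[OF rt Diff_subset, of "insert v R"] par(1) z vz nochild R_def by blast
      \<comment> \<open>If nothing but \<open>x\<close> is left, then \<open>x\<close> is one more
        leaf at \<open>v\<close>, and the first alternative holds.\<close>
      moreover have "\<exists>c. star G c U" if "\<not> 2 \<le> card (U - insert v R)"
      proof -
        have "U - insert v R = {x}"
        proof (rule card_seteq[symmetric])
          show "{x} \<subseteq> U - insert v R" using x vR by blast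
        qed (use that fin in auto)
        then have U: "U = insert v (insert x R)" using v R_def x by blast
        have "star G v U"
          unfolding star_def
        proof (intro conjI ballI)
          fix a b assume ab: "a \<in> U" "b \<in> U"
          have pd: "\<And>w y. w \<in> R \<Longrightarrow> y \<in> U \<Longrightarrow> (w, y) \<in> parcs G \<longleftrightarrow> y = v"
            using pend by (auto simp: pendants_def)
          have vx: "(v, x) \<in> parcs G" using stem x(1) vR by (auto simp: stem_def)
          show "(a, b) \<in> parcs G \<longleftrightarrow> (a = v) \<noteq> (b = v)"
            using ab pd arc_sym arc_irrefl vx vR U by (metis insertE)
        qed (rule v)
        then show ?thesis by blast
      qed
      ultimately show ?thesis using stem by blast
    qed
  qed
qed

section \<open>Costs of stars\<close>

lemma cost_singleton: "cost G {v} = 1"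
proof -
  have "cost G {v} \<le> 1"
    using cost_isolated[of "{v}" "{v}"] arc_irrefl by (simp add: cost_empty)
  then show ?thesis using card_le_cost[of "{v}"] by simp
qed

lemma star_cost_le:
  assumes "finite U" "star G c U" "card U \<le> tri (Suc k)"
  shows "cost G U \<le> card U + k"
proof -
  have c: "c \<in> U" and arc: "\<And>a b. a \<in> U \<Longrightarrow> b \<in> U \<Longrightarrow> (a, b) \<in> parcs G \<longleftrightarrow> (a = c) \<noteq> (b = c)"
    using assms(2) unfolding star_def by simp_all
  have "cost G U \<le> cost G (U - (U - {c})) + card (U - {c}) + k"
  proof (rule cost_remove_pendants_le)
    show "pendants G c (U - {c}) U" using c arc by (auto simp: pendants_def)
    show "card (U - {c}) < tri (Suc k)" using assms card.remove[OF assms(1) c] by simp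
  qed (rule assms)
  also have "U - (U - {c}) = {c}" using c by blast
  finally show ?thesis using card.remove[OF assms(1) c] by (simp add: cost_singleton)
qed

lemma star_cost_ge:
  assumes "finite U" "star G c U" "tri k < card U"
  shows "card U + k \<le> cost G U"
proof -
  have c: "c \<in> U" and arc: "\<And>a b. a \<in> U \<Longrightarrow> b \<in> U \<Longrightarrow> (a, b) \<in> parcs G \<longleftrightarrow> (a = c) \<noteq> (b = c)"
    using assms(2) unfolding star_def by simp_all
  have "card (U - {c}) + 1 + k \<le> cost G (insert c (U - {c}))"
  proof (rule cost_star_ge)
    show "(c, w) \<in> parcs G" if "w \<in> U - {c}" for w using that arc c by blast
    show "tri k \<le> card (U - {c})" using assms(3) card.remove[OF assms(1) c] by simp
  qed (use assms(1) in auto)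
  moreover have "insert c (U - {c}) = U" using c by blast
  ultimately show ?thesis using card.remove[OF assms(1) c] by simp
qed

section \<open>Excess of the cost of a tree over its number of vertices\<close>

lemma stem_card:
  assumes "finite U" "stem G v x R U"
  shows "card U = card (U - R) + card R" "card (U - R) = Suc (card (U - insert v R))"
    "insert v R \<union> (U - insert v R) = U" "1 \<le> card R" "finite R"
proof -
  have R: "R \<subseteq> U" "v \<in> U - R" "R \<noteq> {}" using assms by (auto simp: stem_def pendants_def)
  then show fin: "finite R" using assms(1) finite_subset by blast
  show "card U = card (U - R) + card R"
    using R assms(1) fin by (simp add: card_Diff_subset card_mono)
  show "card (U - R) = Suc (card (U - insert v R))"
    using card.remove[of "U - R" v] R assms(1) Diff_insert[of U v R] by simp
  show "insert v R \<union> (U - insert v R) = U" using R by blast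
  show "1 \<le> card R" using R fin by (simp add: Suc_le_eq card_gt_0_iff)
qed

text \<open>The star at \<open>v\<close> uses up \<open>i\<close> of the excess \<open>e\<close>,
  and \<open>j\<close> is what is left for the remaining tree, whose size the lower bound then
  limits. When \<open>card R\<close> is one short of \<open>tri (Suc i)\<close>,
  \<open>cost_remove_pendants_ge\<close> gives the stronger estimate that keeps \<open>v\<close> in
  the remainder. The lower bound enters as a hypothesis so that the lemma serves both inside its
  induction and afterwards.\<close>

lemma stem_excess:
  assumes "finite U" "stem G v x R U" "cost G U \<le> card U + e"
    and tree: "tree_on G (U - R)" "tree_on G (U - insert v R)" and two: "2 \<le> card (U - insert v R)"
    and IH: "\<And>W j. W \<subset> U \<Longrightarrow> tree_on G W \<Longrightarrow> tri j < card W \<Longrightarrow> card W + j \<le> cost G W"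
    and i: "tri i \<le> card R" "card R < tri (Suc i)"
  shows "\<exists>j\<ge>1. e = i + j
    \<and> (Suc (card R) < tri (Suc i) \<and> cost G (U - insert v R) \<le> card (U - insert v R) + j
          \<and> card (U - insert v R) \<le> tri (Suc j)
      \<or> Suc (card R) = tri (Suc i) \<and> cost G (U - R) \<le> card (U - R) + j
          \<and> card (U - R) \<le> tri (Suc j))"
proof -
  note c = stem_card[OF assms(1,2)]
  have st: "pendants G v R U" "R \<noteq> {}" "x \<in> U - insert v R" "\<And>y. y \<in> U - R \<Longrightarrow> (v, y) \<in> parcs G \<Longrightarrow> y = x"
    using assms(2) by (auto simp: stem_def)
  then have R: "R \<subseteq> U" "v \<in> U" "v \<notin> R" "v \<noteq> x" by (auto simp: pendants_def)
  have "card R + 1 + i \<le> cost G (insert v R)"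
    using c R i st(1) arc_sym unfolding pendants_def by (intro cost_star_ge) blast+
  moreover have "cost G (insert v R) + cost G (U - insert v R) \<le> cost G U"
    using cost_superadditive[of "insert v R" "U - insert v R"] c assms(1) by simp
  ultimately have A: "cost G (U - insert v R) + i \<le> card (U - insert v R) + e"
    using assms(3) c by linarith
  \<comment> \<open>This is the lower bound with \<open>j = 1\<close>, as \<open>tri 1 < 2\<close>;
    it makes the second share of the excess positive.\<close>
  have "card (U - insert v R) + 1 \<le> cost G (U - insert v R)"
    using R two by (intro IH tree) auto
  then have "i < e" using A by linarith
  then obtain j where j: "e = i + j" "1 \<le> j" using less_imp_add_positive[of i e] by auto
  have small: "card W \<le> tri (Suc j)" if "W \<subset> U" "tree_on G W" "cost G W \<le> card W + j" for W
    using IH[OF that(1,2), of "Suc j"] that(3) by (cases "card W \<le> tri (Suc j)") auto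
  show ?thesis
  proof (cases "Suc (card R) = tri (Suc i)")
    case True
    have "cost G (U - R) + card R + i \<le> cost G U"
      using assms(1) st R True by (intro cost_remove_pendants_ge) auto
    then have "cost G (U - R) \<le> card (U - R) + j" using assms(3) c j by linarith
    moreover have "U - R \<subset> U" using R st by blast
    ultimately show ?thesis using small tree True j by blast
  next
    case False
    have "cost G (U - insert v R) \<le> card (U - insert v R) + j" using A j by linarith
    moreover have "U - insert v R \<subset> U" using R by blast
    moreover have "Suc (card R) < tri (Suc i)" using False i by linarith
    ultimately show ?thesis using small tree j by blast
  qed
qed

text \<open>Stars meet this bound, so they minimize. A nonstar with excess \<open>e < k\<close>
  would split \<open>e = i + j\<close> with both parts positive, and \<open>tri_add\<close> would
  limit its size to \<open>tri (Suc e) \<le> tri k\<close>.\<close>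

lemma tree_cost_ge:
  assumes "tree_on G U" "tri k < card U"
  shows "card U + k \<le> cost G U"
  using assms
proof (induction "card U" arbitrary: U k rule: less_induct)
  case less
  note fin = tree_on_finite[OF less.prems(1)]
  have IH: "card W + j \<le> cost G W" if "W \<subset> U" "tree_on G W" "tri j < card W" for W j
    using that fin by (intro less.hyps psubset_card_mono) auto
  show ?case
  proof (cases "\<exists>c. star G c U")
    case True
    then show ?thesis using star_cost_ge fin less.prems by blast
  next
    case False
    with tree_decomposition[OF less.prems(1)] obtain v x R where st: "stem G v x R U"
      and tr: "tree_on G (U - R)" "tree_on G (U - insert v R)" "2 \<le> card (U - insert v R)" by blast
    note c = stem_card[OF fin st]
    show ?thesis
    proof (rule ccontr)
      assume no: "\<not> ?thesis"
      obtain e where e: "cost G U \<le> card U + e" "e < k"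
      proof (cases "card U \<le> cost G U")
        case True
        then show thesis using no that[of "cost G U - card U"] by simp
      qed (use card_le_cost[OF fin] in simp)
      obtain i where i: "tri i \<le> card R" "card R < tri (Suc i)" by (rule tri_between)
      from stem_excess[OF fin st e(1) tr IH i] obtain j where j: "e = i + j" "1 \<le> j"
        and sz: "card U + 1 \<le> tri (Suc i) + tri (Suc j)"
        using c by fastforce
      have "1 \<le> i" using i c by (cases i) auto
      then have "1 \<le> i * j" using j by simp
      then have "card U \<le> tri (Suc e)" using sz tri_add[of i j] j by simp
      also have "\<dots> \<le> tri k" using e by (intro tri_mono) simp
      finally show False using less.prems by simp
    qed
  qed
qed

text \<open>This is \<open>stem_excess\<close> with the lower bound now available. Both alternatives
  lead to the same size estimate through \<open>tri_add\<close>.\<close>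

lemma tree_excess:
  assumes "tree_on G U" "cost G U \<le> card U + e" "\<And>c. \<not> star G c U"
  obtains v x R i j where "stem G v x R U" "tree_on G (U - R)" "tree_on G (U - insert v R)"
    "2 \<le> card (U - insert v R)" "1 \<le> i" "1 \<le> j" "e = i + j" "tri i \<le> card R"
    "Suc (card R) < tri (Suc i) \<and> cost G (U - insert v R) \<le> card (U - insert v R) + j
          \<and> card (U - insert v R) \<le> tri (Suc j)
      \<or> Suc (card R) = tri (Suc i) \<and> cost G (U - R) \<le> card (U - R) + j
          \<and> card (U - R) \<le> tri (Suc j)"
    "card U + i * j \<le> tri (Suc e)"
proof -
  note fin = tree_on_finite[OF assms(1)]
  from tree_decomposition[OF assms(1)] assms(3) obtain v x R where st: "stem G v x R U"
      and tr: "tree_on G (U - R)" "tree_on G (U - insert v R)" "2 \<le> card (U - insert v R)" by blast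
  note c = stem_card[OF fin st]
  obtain i where i: "tri i \<le> card R" "card R < tri (Suc i)" by (rule tri_between)
  have "1 \<le> i" using i c by (cases i) auto
  from stem_excess[OF fin st assms(2) tr tree_cost_ge i] obtain j where j: "e = i + j" "1 \<le> j"
    and alt: "Suc (card R) < tri (Suc i) \<and> cost G (U - insert v R) \<le> card (U - insert v R) + j
          \<and> card (U - insert v R) \<le> tri (Suc j)
      \<or> Suc (card R) = tri (Suc i) \<and> cost G (U - R) \<le> card (U - R) + j
          \<and> card (U - R) \<le> tri (Suc j)" by blast
  then have "card U + 1 \<le> tri (Suc i) + tri (Suc j)" using c by fastforce
  then have "card U + i * j \<le> tri (Suc e)" using tri_add[of i j] j by simp
  then show thesis using that st tr \<open>1 \<le> i\<close> j i alt by blast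
qed

text \<open>For a nonstar the size estimate forces \<open>i * j \<le> 1\<close>, hence
  \<open>i = j = 1\<close>, \<open>e = 2\<close> and five vertices. This one exceptional size is the
  source of the exception at seven vertices.\<close>

lemma near_triangular_star:
  assumes "tree_on G W" "cost G W \<le> card W + e" "tri (Suc e) \<le> card W + 1" "2 \<le> e" "card W \<noteq> 5"
  shows "\<exists>c. star G c W"
proof (rule ccontr)
  assume "\<not> ?thesis"
  then have nonstar: "\<And>c. \<not> star G c W" by blast
  obtain i j where ij: "1 \<le> i" "1 \<le> j" "e = i + j" "card W + i * j \<le> tri (Suc e)"
    by (rule tree_excess[OF assms(1,2) nonstar])
  have "i * j \<le> 1" using ij(4) assms(3) by linarith
  then have "i = 1" "j = 1" using ij(1,2) by (cases i; cases j; auto)+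
  then have "card W = 5" using ij(3,4) assms(3) by (simp add: numeral_eq_Suc)
  then show False using assms(5) by simp
qed

text \<open>Painter needs at most 3/2 points per vertex. For seven vertices this gives cost at most
  10, which is the minimum, so every such tree is a minimizer.\<close>

lemma tree_cost_upper:
  assumes "tree_on G U"
  shows "2 * cost G U \<le> 3 * card U"
  using assms
proof (induction "card U" arbitrary: U rule: less_induct)
  case less
  note fin = tree_on_finite[OF less.prems(1)]
  show ?case
  proof (cases "\<exists>c. star G c U")
    case True
    then obtain c where c: "star G c U" by blast
    then have "0 < card U" using fin by (auto simp: star_def card_gt_0_iff)
    obtain k where k: "tri k \<le> card U - 1" "card U - 1 < tri (Suc k)" by (rule tri_between)
    have "2 * k \<le> tri k + 1"
    proof (induction k)
      case (Suc k)
      then show ?case by (cases k) auto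
    qed simp
    then show ?thesis using star_cost_le[OF fin c, of k] k \<open>0 < card U\<close> by linarith
  next
    case False
    with tree_decomposition[OF less.prems(1)] obtain v x R where st: "stem G v x R U"
      and tr: "tree_on G (U - R)" "tree_on G (U - insert v R)" by blast
    note c = stem_card[OF fin st]
    have pend: "pendants G v R U" "v \<noteq> x" "\<And>y. y \<in> U - R \<Longrightarrow> (v, y) \<in> parcs G \<Longrightarrow> y = x"
      using st by (auto simp: stem_def)
    show ?thesis
    \<comment> \<open>Removing two leaves together with \<open>v\<close> would be charged 5 points
      for three vertices, which is too much; removing only the leaves is charged 3 points for
      two.\<close>
    proof (cases "card R = 2")
      case True
      have "cost G U \<le> cost G (U - R) + card R + 1"
        using fin pend True by (intro cost_remove_pendants_le) auto
      moreover have "2 * cost G (U - R) \<le> 3 * card (U - R)"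
        using c by (intro less.hyps tr) auto
      ultimately show ?thesis using c True by linarith
    next
      case False
      obtain k where k: "tri k \<le> Suc (card R)" "Suc (card R) < tri (Suc k)" by (rule tri_between)
      have "cost G U \<le> cost G (U - insert v R) + card R + 1 + k"
        using fin pend k by (intro cost_remove_stem_le) auto
      moreover have "2 * cost G (U - insert v R) \<le> 3 * card (U - insert v R)"
        using c by (intro less.hyps tr) auto
      moreover have "2 * k \<le> Suc (card R)"
      proof (cases "k \<le> 2")
        case True
        then consider "k = 0" | "k = 1" | "k = 2" by linarith
        then show ?thesis
        proof cases
          case 2
          then show ?thesis using c by linarith
        next
          case 3
          then have "3 \<le> Suc (card R)" using k by (simp add: numeral_2_eq_2)
          then show ?thesis using False 3 by linarith
        qed simp
      next
        case 3: False
        have "2 * k \<le> tri k" if "3 \<le> k" for k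
          using that by (induction k rule: dec_induct) (simp_all add: numeral_3_eq_3)
        from this[of k] show ?thesis using k 3 by linarith
      qed
      ultimately show ?thesis using c by linarith
    qed
  qed
qed

section \<open>Shape of the minimizing trees\<close>

text \<open>In \<open>U - R\<close> the vertex \<open>v\<close> has \<open>x\<close> as its only
  neighbor, so with three or more vertices it cannot be the center of the star, and its neighbor
  must be.\<close>

lemma star_tree_remove_stem:
  assumes "stem G v x R U" "star G c (U - R)" "3 \<le> card (U - R)"
  shows "c = x \<and> star G x (U - insert v R)"
proof -
  have st: "v \<in> U - R" "x \<in> U - insert v R" "\<And>y. y \<in> U - R \<Longrightarrow> (v, y) \<in> parcs G \<longleftrightarrow> y = x"
    using assms(1) by (auto simp: stem_def pendants_def)
  have sc: "c \<in> U - R" "\<And>a b. a \<in> U - R \<Longrightarrow> b \<in> U - R \<Longrightarrow> (a, b) \<in> parcs G \<longleftrightarrow> (a = c) \<noteq> (b = c)"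
    using assms(2) unfolding star_def by simp_all
  have "v \<noteq> c"
  proof
    assume "v = c"
    then have "U - R \<subseteq> {v, x}" using st sc by blast
    then have "card (U - R) \<le> card {v, x}" by (intro card_mono) auto
    then show False using assms(3) card_insert_le_m1[of 2 "{x}" v] by simp
  qed
  then have "c = x" using st sc by blast
  then show ?thesis using sc st by (auto simp: star_def)
qed

lemma small_tree_star:
  assumes "tree_on G W" "card W \<le> 3"
  shows "\<exists>c. star G c W"
proof (rule ccontr)
  assume "\<not> ?thesis"
  with tree_decomposition[OF assms(1)] obtain v x R where st: "stem G v x R W"
    and two: "2 \<le> card (W - insert v R)" by blast
  show False using stem_card[OF tree_on_finite[OF assms(1)] st] two assms(2) by linarith
qed

text \<open>Both ends of a single edge are centers, so the attachment vertex can be chosen as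
  center.\<close>

lemma star_two:
  assumes "star G c W" "card W = 2" "x \<in> W"
  shows "star G x W"
proof (cases "x = c")
  case False
  have "W = {c, x}" using assms False
    by (intro card_seteq[symmetric]) (auto simp: star_def intro: card_ge_0_finite)
  then show ?thesis using assms False by (auto simp: star_def)
qed (use assms in simp)

text \<open>As \<open>card U\<close> exceeds \<open>tri K\<close>, the size estimate yields
  \<open>i * j \<le> i + j\<close> and leaves three cases. In each the remainder is a star. If the
  stem is attached at its center, the tree is a double-star; if at a leaf, a subdivided
  double-star.\<close>

lemma minimal_tree_shape:
  assumes tree: "tree_on G U" and cost: "cost G U \<le> card U + K" and K: "tri K < card U"
    and seven: "card U \<noteq> 7" and nonstar: "\<And>c. \<not> star G c U"
  shows "\<exists>v x R c. stem G v x R U \<and> star G c (U - insert v R) \<and> 2 \<le> card (U - insert v R)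
    \<and> (x = c \<and> (card (U - insert v R) \<in> {2, 3} \<or> card R \<in> {1, 2}
              \<or> card U = 11 \<and> card R \<in> {4, 5})
      \<or> x \<noteq> c \<and> (card (U - insert v R) = 3 \<or> card R = 1 \<and> 3 \<le> card (U - insert v R)
              \<or> card U = 11 \<and> card R = 4))"
proof -
  note fin = tree_on_finite[OF tree]
  obtain v x R i j where st: "stem G v x R U" and tr: "tree_on G (U - R)" "tree_on G (U - insert v R)"
    and two: "2 \<le> card (U - insert v R)" and ij: "1 \<le> i" "1 \<le> j" "K = i + j" "tri i \<le> card R"
    and alt: "Suc (card R) < tri (Suc i) \<and> cost G (U - insert v R) \<le> card (U - insert v R) + j
          \<and> card (U - insert v R) \<le> tri (Suc j)
      \<or> Suc (card R) = tri (Suc i) \<and> cost G (U - R) \<le> card (U - R) + j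
          \<and> card (U - R) \<le> tri (Suc j)"
    and size: "card U + i * j \<le> tri (Suc K)"
    by (rule tree_excess[OF tree cost nonstar])
  note c = stem_card[OF fin st]
  let ?A = "U - insert v R"
  have x: "x \<in> ?A" using st by (simp add: stem_def)
  have sz: "card U = card R + card ?A + 1" using c by simp
  have shape: ?thesis if "star G c ?A"
    "x = c \<and> (card ?A \<in> {2, 3} \<or> card R \<in> {1, 2} \<or> card U = 11 \<and> card R \<in> {4, 5})
      \<or> x \<noteq> c \<and> (card ?A = 3 \<or> card R = 1 \<and> 3 \<le> card ?A \<or> card U = 11 \<and> card R = 4)" for c
    using st two that by blast
  have ij_le: "i * j \<le> i + j" using size K ij(3) by simp
  then consider "j = 1" | "i = 1" "2 \<le> j" | "i = 2" "j = 2"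
  proof -
    have "(i - 1) * (j - 1) \<le> 1"
      using ij_le ij(1,2) by (cases i; cases j) (auto simp: algebra_simps)
    then have "i = 1 \<or> j = 1 \<or> i = 2 \<and> j = 2"
      using ij(1,2) by (cases "i - 1"; cases "j - 1") auto
    then show thesis using that ij by force
  qed
  then show ?thesis
  proof cases
    case 1
    then have A3: "card ?A \<le> 3" using alt c by auto
    then obtain c where star: "star G c ?A" using small_tree_star tr by blast
    show ?thesis
    proof (cases "card ?A = 2")
      case True
      then have "star G x ?A" using star_two star x by blast
      then show ?thesis by (rule shape) (simp add: True)
    next
      case False
      then have "card ?A = 3" using A3 two by linarith
      then show ?thesis by (intro shape[OF star]) simp
    qed
  next
    case 2
    then have e: "2 \<le> j" "K = Suc j" using ij by auto
    from alt show ?thesis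
    proof (elim disjE conjE)
      assume a: "Suc (card R) < tri (Suc i)" "cost G ?A \<le> card ?A + j"
      then have R1: "card R = 1" using 2 c by simp
      \<comment> \<open>The remainder has \<open>card U - 2\<close> vertices, hence at least
        \<open>tri (Suc j) - 1\<close>; size five would mean \<open>card U = 7\<close>.\<close>
      then obtain c where star: "star G c ?A"
        using K seven e sz by (atomize_elim, intro near_triangular_star[OF tr(2) a(2)]) auto
      moreover have "3 \<le> card ?A" using K sz e R1 tri_mono[of 3 K] by (simp add: numeral_eq_Suc)
      ultimately show ?thesis by (intro shape[OF star]) (simp add: R1)
    next
      assume a: "Suc (card R) = tri (Suc i)" "cost G (U - R) \<le> card (U - R) + j"
      then have R2: "card R = 2" using 2 c by simp
      then obtain c where "star G c (U - R)"
        using K seven e sz c near_triangular_star[OF tr(1) a(2)] by auto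
      moreover have "3 \<le> card (U - R)" using two c by simp
      ultimately have "star G x ?A" using star_tree_remove_stem[OF st] by blast
      then show ?thesis by (rule shape) (simp add: R2)
    qed
  next
    case 3
    \<comment> \<open>Here \<open>K = 4\<close>, so \<open>tri 4 < card U\<close> and
      \<open>card U + 4 \<le> tri 5\<close>.\<close>
    then have n: "card U = 11" using size K ij by (simp add: numeral_eq_Suc)
    from alt show ?thesis
    proof (elim disjE conjE)
      assume a: "Suc (card R) < tri (Suc i)" "cost G ?A \<le> card ?A + j" "card ?A \<le> tri (Suc j)"
      then have R4: "card R = 4" "card ?A = 6" using 3 n sz by (auto simp: numeral_eq_Suc)
      then obtain c where star: "star G c ?A"
        using 3 by (atomize_elim, intro near_triangular_star[OF tr(2) a(2)]) (auto simp: numeral_eq_Suc)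
      show ?thesis by (intro shape[OF star]) (auto simp: R4 n)
    next
      assume a: "Suc (card R) = tri (Suc i)" "cost G (U - R) \<le> card (U - R) + j" "card (U - R) \<le> tri (Suc j)"
      then have R5: "card R = 5" "card (U - R) = 6" using 3 n c by (auto simp: numeral_eq_Suc)
      then obtain c where "star G c (U - R)"
        using 3 near_triangular_star[OF tr(1) a(2)] by (auto simp: numeral_eq_Suc)
      then have "star G x ?A" using star_tree_remove_stem[OF st] R5 by auto
      then show ?thesis by (rule shape) (simp add: R5 n)
    qed
  qed
qed

end

section \<open>Rooted trees and cycles\<close>

lemma pcas_nth:
  assumes "pcas u p v" "p \<noteq> []"
  shows "fst (p ! 0) = u" "snd (p ! (length p - 1)) = v"
    "Suc i < length p \<Longrightarrow> fst (p ! Suc i) = snd (p ! i)"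
proof -
  have "p \<noteq> [] \<longrightarrow> fst (p ! 0) = u \<and> snd (p ! (length p - 1)) = v
      \<and> (\<forall>i. Suc i < length p \<longrightarrow> fst (p ! Suc i) = snd (p ! i))"
    using assms(1)
  proof (induction p arbitrary: u)
    case (Cons e p)
    show ?case
    proof (cases "p = []")
      case True
      then show ?thesis using Cons.prems by simp
    next
      case False
      then have IH: "fst (p ! 0) = snd e" "snd (p ! (length p - 1)) = v"
        "\<And>i. Suc i < length p \<Longrightarrow> fst (p ! Suc i) = snd (p ! i)"
        using Cons.IH[of "snd e"] Cons.prems by auto
      have "fst ((e # p) ! Suc i) = snd ((e # p) ! i)" if "Suc i < length (e # p)" for i
        using that IH by (cases i) auto
      then show ?thesis using IH False Cons.prems by (simp add: nth_Cons')
    qed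
  qed simp
  then show "fst (p ! 0) = u" "snd (p ! (length p - 1)) = v"
    "Suc i < length p \<Longrightarrow> fst (p ! Suc i) = snd (p ! i)" using assms(2) by auto
qed

lemma pawalk_verts_pcas: "pcas u p v \<Longrightarrow> pawalk_verts u p = map fst p @ [v]"
  by (induction p arbitrary: u) auto

context pair_graph
begin

lemma connected_iff_rtrancl:
  "connected (with_proj G) \<longleftrightarrow> pverts G \<noteq> {} \<and> (\<forall>u\<in>pverts G. \<forall>v\<in>pverts G. (u, v) \<in> (parcs G)\<^sup>*)"
proof -
  have "(parcs G)\<^sup>s = parcs G" using arc_sym by (auto simp: symcl_def)
  then have "connected (with_proj G) \<longleftrightarrow>
      pverts G \<noteq> {} \<and> (\<forall>u\<in>pverts G. \<forall>v\<in>pverts G. u \<rightarrow>\<^sup>*\<^bsub>with_proj G\<^esub> v)"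
    by (simp add: connected_conv reachable_def)
  then show ?thesis using reachable_conv' by simp
qed

text \<open>
  The parents are those of a breadth-first search from \<open>z\<close>. An arc that is not a parent arc would
  close a cycle with a path of parent arcs.
\<close>

lemma is_tree_imp_tree_on:
  assumes "is_tree G"
  shows "tree_on G (pverts G)"
proof -
  define V where "V = pverts G"
  have con: "V \<noteq> {}" "\<And>u v. u \<in> V \<Longrightarrow> v \<in> V \<Longrightarrow> (u, v) \<in> (parcs G)\<^sup>*"
    and acyclic: "\<And>p. cycle p \<Longrightarrow> length p < 3"
    using assms connected_iff_rtrancl unfolding is_tree_def V_def by (auto simp: not_le)
  obtain z where z: "z \<in> V" using con by blast
  define d where "d v = (LEAST n. (v, z) \<in> parcs G ^^ n)" for v
  have dwit: "(v, z) \<in> parcs G ^^ d v" if "v \<in> V" for v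
  proof -
    have "\<exists>n. (v, z) \<in> parcs G ^^ n" using con(2)[OF that z] by (rule rtrancl_imp_relpow)
    then show ?thesis unfolding d_def by (rule LeastI_ex)
  qed
  have "\<exists>y. (v, y) \<in> parcs G \<and> d v = Suc (d y)" if v: "v \<in> V" "v \<noteq> z" for v
  proof -
    obtain n where n: "d v = Suc n" using dwit[OF v(1)] v(2) by (cases "d v") auto
    then obtain y where y: "(v, y) \<in> parcs G" "(y, z) \<in> parcs G ^^ n"
      using dwit[OF v(1)] by (metis relpow_Suc_D2)
    have "d y \<le> n" unfolding d_def using y(2) by (rule Least_le)
    moreover have "y \<in> V" using y(1) in_arcsD2 V_def by blast
    then have "(v, z) \<in> parcs G ^^ Suc (d y)" using y(1) dwit by (meson relpow_Suc_I2)
    then have "d v \<le> Suc (d y)" unfolding d_def by (rule Least_le)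
    ultimately show ?thesis using y n by auto
  qed
  then obtain p where p: "\<And>v. v \<in> V \<Longrightarrow> v \<noteq> z \<Longrightarrow> (v, p v) \<in> parcs G \<and> d v = Suc (d (p v))"
    by metis
  have pV: "p v \<in> V" if "v \<in> V" "v \<noteq> z" for v using p[OF that] in_arcsD2 V_def by blast
  define S where "S = {(w, p w) |w. w \<in> V - {z}}"
  define F where "F = S \<union> S\<inverse>"
  have F: "F \<subseteq> parcs G" using p arc_sym unfolding F_def S_def by blast
  have symF: "sym F" unfolding F_def by (rule sym_Un_converse)
  have toz: "(v, z) \<in> F\<^sup>*" if "v \<in> V" for v
    using that
  proof (induction "d v" arbitrary: v rule: less_induct)
    case less
    show ?case
    proof (cases "v = z")
      case False
      then have "(v, p v) \<in> F" using less.prems unfolding F_def S_def by blast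
      moreover have "(p v, z) \<in> F\<^sup>*" using p[OF less.prems False] pV[OF less.prems False] less.hyps by simp
      ultimately show ?thesis by (rule converse_rtrancl_into_rtrancl)
    qed simp
  qed
  define H where "H = \<lparr>pverts = V, parcs = F\<rparr>"
  have FV: "F \<subseteq> V \<times> V" using F in_arcsD1 in_arcsD2 V_def by fast
  interpret H: pair_wf_digraph H
    by unfold_locales (use FV H_def in auto)
  have sub: "subgraph (with_proj H) (with_proj G)"
  proof (rule subgraphI)
    show "wf_digraph (with_proj H)" by unfold_locales
    show "wf_digraph (with_proj G)" by unfold_locales
  qed (use F H_def V_def in \<open>auto simp: compatible_def\<close>)
  have "(a, b) \<in> F" if ab: "(a, b) \<in> parcs G" for a b
  proof (rule ccontr)
    assume no: "(a, b) \<notin> F"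
    have V: "a \<in> V" "b \<in> V" using ab in_arcsD1 in_arcsD2 V_def by blast+
    have "(z, a) \<in> F\<^sup>*" using toz[OF V(1)] sym_rtrancl[OF symF] by (meson symD)
    then have "(b, a) \<in> F\<^sup>*" using toz[OF V(2)] by simp
    then have "b \<rightarrow>\<^sup>*\<^bsub>with_proj H\<^esub> a" using H.reachable_conv'[of b a] V by (simp add: H_def)
    then obtain q where q: "H.apath b q a" using H.reachable_apath by blast
    have awalk_H: "H.awalk b q a" and dist: "distinct (pawalk_verts b q)"
      using q unfolding H.apath_def by simp_all
    have "set q \<subseteq> parcs H" using awalk_H unfolding H.awalk_def by simp
    then have qF: "set q \<subseteq> F" by (simp add: H_def)
    note walk = subgraph_awalk_imp_awalk[OF awalk_H sub] dist qF
    have "cycle ((a, b) # q)"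
      unfolding cycle_def using walk ab by (intro exI[of _ a]) (auto simp: awalk_Cons_iff)
    \<comment> \<open>Only closed walks of length one or two remain: the first would be a loop, the
      second would have the reverse of \<open>(a, b)\<close> in the symmetric set
      \<open>F\<close>.\<close>
    then have "length q < 2" using acyclic by fastforce
    then consider "q = []" | e where "q = [e]" by (cases q; cases "tl q") auto
    then show False
    proof cases
      case 1
      then show False using walk(1) ab arc_irrefl by (auto simp: awalk_def)
    next
      case 2
      then have "(b, a) \<in> F" using walk(1,3) by (cases e) (auto simp: awalk_def)
      then show False using no symF by (meson symD)
    qed
  qed
  then have FE: "F = parcs G" using F by auto
  have "rooted G V z p d"
    unfolding rooted_def FE[symmetric] F_def S_def
    using z p pV pair_finite_verts V_def by auto
  then show ?thesis unfolding tree_on_def V_def by blast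
qed

lemma tree_on_imp_is_tree:
  assumes "tree_on G (pverts G)"
  shows "is_tree G"
proof -
  define V where "V = pverts G"
  obtain z p d where "rooted G V z p d" using assms unfolding tree_on_def V_def by blast
  then have z: "z \<in> V"
    and par: "\<And>w. w \<in> V \<Longrightarrow> w \<noteq> z \<Longrightarrow> p w \<in> V \<and> d w = Suc (d (p w))"
    and arc: "\<And>a b. a \<in> V \<Longrightarrow> b \<in> V \<Longrightarrow> (a, b) \<in> parcs G \<longleftrightarrow> a \<noteq> z \<and> b = p a \<or> b \<noteq> z \<and> a = p b"
    unfolding rooted_def by simp_all
  have sym: "sym (parcs G)" using arc_sym by (meson symI)
  have toz: "(v, z) \<in> (parcs G)\<^sup>*" if "v \<in> V" for v
    using that
  proof (induction "d v" arbitrary: v rule: less_induct)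
    case less
    show ?case
    proof (cases "v = z")
      case False
      note pv = par[OF less.prems False]
      have "(v, p v) \<in> parcs G" using arc[of v "p v"] less.prems False pv by blast
      moreover have "(p v, z) \<in> (parcs G)\<^sup>*" using pv less.hyps by simp
      ultimately show ?thesis by (rule converse_rtrancl_into_rtrancl)
    qed simp
  qed
  have "(u, v) \<in> (parcs G)\<^sup>*" if "u \<in> V" "v \<in> V" for u v
    using toz[OF that(1)] toz[OF that(2)] sym_rtrancl[OF sym] by (meson rtrancl_trans symD)
  then have con: "connected (with_proj G)" using z connected_iff_rtrancl V_def by blast
  have False if c: "cycle q" and len: "3 \<le> length q" for q
  proof -
    obtain u where u: "awalk u q u" "distinct (tl (pawalk_verts u q))"
      using c by (auto simp: cycle_def)
    have cas: "pcas u q u" and arcs: "set q \<subseteq> parcs G" using u(1) by (auto simp: awalk_def)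
    have "q \<noteq> []" using len by auto
    note nth = pcas_nth[OF cas this]
    define l where "l = length q"
    have next': "fst (q ! (Suc i mod l)) = snd (q ! i)" if "i < l" for i
    proof (cases "Suc i = l")
      case True
      then have "i = length q - 1" by (simp add: l_def)
      then show ?thesis using nth(1,2) True by simp
    next
      case False
      then show ?thesis using nth(3)[of i] that by (simp add: l_def)
    qed
    have "distinct (map fst q)"
    proof -
      have "distinct (tl (map fst q) @ [u])"
        using u(2) pawalk_verts_pcas[OF cas] \<open>q \<noteq> []\<close> by (cases q) auto
      moreover have "hd (map fst q) = u" using nth(1) \<open>q \<noteq> []\<close> by (cases q) auto
      ultimately show ?thesis using \<open>q \<noteq> []\<close> by (cases q) auto
    qed
    then have inj: "i = j" if "fst (q ! i) = fst (q ! j)" "i < l" "j < l" for i j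
      using that nth_eq_iff_index_eq[of "map fst q" i j] by (simp add: l_def)
    have l: "3 \<le> l" using len by (simp add: l_def)
    have "Max ((\<lambda>i. d (snd (q ! i))) ` {..<l}) \<in> (\<lambda>i. d (snd (q ! i))) ` {..<l}"
      using l by (intro Max_in) (auto simp: lessThan_empty_iff)
    then obtain i where i: "i < l" and mx: "Max ((\<lambda>i. d (snd (q ! i))) ` {..<l}) = d (snd (q ! i))"
      by auto
    have max: "d (snd (q ! j)) \<le> d (snd (q ! i))" if "j < l" for j
      unfolding mx[symmetric] using that by (intro Max_ge) auto
    have V: "fst (q ! j) \<in> V" "snd (q ! j) \<in> V" "q ! j \<in> parcs G" if "j < l" for j
    proof -
      show "q ! j \<in> parcs G" using that arcs l_def nth_mem by blast
      then show "fst (q ! j) \<in> V" "snd (q ! j) \<in> V" using arc_fst_in_verts arc_snd_in_verts V_def by auto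
    qed
    \<comment> \<open>Both neighbors on the cycle of a deepest vertex \<open>y\<close> are its parent.\<close>
    define y where "y = snd (q ! i)"
    have top: "y \<noteq> z \<and> t = p y" if t: "t \<in> V" "(t, y) \<in> parcs G" "d t \<le> d y" for t
    proof -
      have yV: "y \<in> V" using V i y_def by blast
      have "\<not> (t \<noteq> z \<and> y = p t)" using par[OF t(1)] t(3) by auto
      then show ?thesis using arc[OF t(1) yV] t(2) by blast
    qed
    define i1 where "i1 = Suc i mod l"
    define i2 where "i2 = Suc i1 mod l"
    have lt: "i1 < l" "i2 < l" using l i1_def i2_def by auto
    have y1: "fst (q ! i1) = y" using next'[OF i] i1_def y_def by simp
    \<comment> \<open>Maximality of the depth is stated for heads of arcs, so the tail of arc
      \<open>i\<close> is viewed as the head of the preceding arc \<open>j\<close>.\<close>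
    obtain j where j: "j < l" "Suc j mod l = i"
    proof (cases i)
      case 0
      then show thesis using that[of "l - 1"] l by simp
    next
      case (Suc m)
      then show thesis using that[of m] i by simp
    qed
    have "fst (q ! i) = p y"
    proof (rule top[THEN conjunct2])
      show "d (fst (q ! i)) \<le> d y" using next'[OF j(1)] j max[OF j(1)] y_def by simp
      show "(fst (q ! i), y) \<in> parcs G" using V(3)[OF i] y_def by simp
    qed (use V i in auto)
    moreover have "snd (q ! i1) = p y"
    proof (rule top[THEN conjunct2])
      show "d (snd (q ! i1)) \<le> d y" using max[OF lt(1)] y_def by simp
      show "(snd (q ! i1), y) \<in> parcs G" using V(3)[OF lt(1)] y1 arc_sym by (metis prod.collapse)
    qed (use V lt in auto)
    \<comment> \<open>Arcs \<open>i\<close> and \<open>i + 2\<close> start at the same vertex, hence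
      coincide modulo a length of at least three, which is impossible.\<close>
    ultimately have "fst (q ! i2) = fst (q ! i)" using next'[OF lt(1)] i2_def by simp
    then have "i2 = i" using inj lt i by blast
    then show False
      using i l unfolding i2_def i1_def by (auto simp: mod_Suc split: if_splits)
  qed
  then show ?thesis unfolding is_tree_def using con pair_graph by blast
qed

end

section \<open>Stars and double-stars\<close>

lemma leaf_iff: "leaf G v \<longleftrightarrow> v \<in> pverts G \<and> card {w. (v, w) \<in> parcs G} = 1"
proof -
  have "out_arcs (with_proj G) v = Pair v ` {w. (v, w) \<in> parcs G}"
    by (auto simp: out_arcs_def)
  then have "out_degree (with_proj G) v = card {w. (v, w) \<in> parcs G}"
    by (simp add: out_degree_def card_image inj_on_def)
  then show ?thesis by (simp add: leaf_def)
qed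

text \<open>Explicit adjacency of a double-star with centers \<open>u\<close>, \<open>v\<close> and
  leaf sets \<open>A\<close>, \<open>B\<close>, replacing the counting conditions of
  \<open>double_star_centers\<close>.\<close>

definition double_star_arcs :: "'a \<Rightarrow> 'a \<Rightarrow> 'a set \<Rightarrow> 'a set \<Rightarrow> 'a rel" where
  "double_star_arcs u v A B =
    (let S = {u} \<times> A \<union> {v} \<times> B \<union> {(u, v)} in S \<union> S\<inverse>)"

lemma double_star_arcs_iff:
  "(s, t) \<in> double_star_arcs u v A B \<longleftrightarrow>
    s = u \<and> t \<in> A \<or> s = v \<and> t \<in> B \<or> s = u \<and> t = v
    \<or> t = u \<and> s \<in> A \<or> t = v \<and> s \<in> B \<or> t = u \<and> s = v"
  by (auto simp: double_star_arcs_def Let_def)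

lemma double_star_centersI:
  assumes V: "pverts G = insert u (insert v (A \<union> B))" and E: "parcs G = double_star_arcs u v A B"
    and fin: "finite A" "finite B" and ne: "A \<noteq> {}" "B \<noteq> {}"
    and disj: "u \<noteq> v" "A \<inter> B = {}" "u \<notin> A \<union> B" "v \<notin> A \<union> B"
  shows "double_star_centers (card A) (card B) G u v"
proof -
  interpret pair_graph G
  proof
    show "finite (pverts G)" using V fin by simp
    show "finite (parcs G)" using fin by (simp add: E double_star_arcs_def Let_def)
    show "symmetric (with_proj G)"
      by (auto simp: symmetric_def E sym_def double_star_arcs_iff)
  qed (use disj in \<open>auto simp: V E double_star_arcs_def Let_def\<close>)
  define p where "p w = (if w \<in> B then v else u)" for w
  define d where "d w = (if w = u then 0 else if w \<in> B then 2 else 1 :: nat)" for w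
  have "rooted G (pverts G) u p d"
    unfolding rooted_def V E double_star_arcs_iff using fin disj
    by (auto simp: p_def d_def)
  then have tree: "is_tree G" using tree_on_imp_is_tree unfolding tree_on_def by blast
  have out_u: "{w. (u, w) \<in> parcs G} = insert v A" and out_v: "{w. (v, w) \<in> parcs G} = insert u B"
    and out_A: "\<And>x. x \<in> A \<Longrightarrow> {w. (x, w) \<in> parcs G} = {u}"
    and out_B: "\<And>x. x \<in> B \<Longrightarrow> {w. (x, w) \<in> parcs G} = {v}"
    unfolding E double_star_arcs_iff using disj by auto
  have "0 < card A" "0 < card B" using fin ne by (auto simp: card_gt_0_iff)
  then have leaf: "leaf G x \<longleftrightarrow> x \<in> A \<union> B" for x
    unfolding leaf_iff V using out_u out_v out_A out_B disj fin
    by (cases "x = u"; cases "x = v") auto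
  have "leaf_neighbors G u = A" "leaf_neighbors G v = B"
    unfolding leaf_neighbors_def leaf using out_u out_v disj by auto
  moreover have "{x \<in> pverts G. \<not> leaf G x} = {u, v}" unfolding leaf V using disj by auto
  moreover have "card (pverts G) = card A + card B + 2"
    unfolding V using fin disj by (simp add: card_Un_disjoint)
  moreover have "(u, v) \<in> parcs G" unfolding E double_star_arcs_iff by simp
  ultimately show ?thesis
    using tree \<open>0 < card A\<close> \<open>0 < card B\<close> disj unfolding double_star_centers_def by simp
qed

text \<open>A leaf has only one neighbor, so the two leaf sets are disjoint, and the count
  \<open>a + b + 2\<close> leaves no other vertex. Every arc except the one between the centers then
  meets a leaf and is determined by it.\<close>

lemma double_star_centersE:
  assumes "double_star_centers a b G u v"
  obtains A B where "pverts G = insert u (insert v (A \<union> B))" "parcs G = double_star_arcs u v A B"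
    "finite A" "finite B" "card A = a" "card B = b" "1 \<le> a" "1 \<le> b"
    "u \<noteq> v" "A \<inter> B = {}" "u \<notin> A \<union> B" "v \<notin> A \<union> B"
proof -
  define A where "A = leaf_neighbors G u"
  define B where "B = leaf_neighbors G v"
  have dsc: "1 \<le> a" "1 \<le> b" "is_tree G" "card (pverts G) = a + b + 2"
    "{x \<in> pverts G. \<not> leaf G x} = {u, v}" "u \<noteq> v" "(u, v) \<in> parcs G" "card A = a" "card B = b"
    using assms unfolding double_star_centers_def A_def B_def by simp_all
  interpret pair_graph G using dsc(3) by (simp add: is_tree_def)
  have uv: "u \<in> pverts G" "v \<in> pverts G" "\<not> leaf G u" "\<not> leaf G v" using dsc(5) by blast+
  have sub: "A \<subseteq> pverts G" "B \<subseteq> pverts G"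
    unfolding A_def B_def leaf_neighbors_def leaf_def by auto
  then have fin: "finite A" "finite B" using pair_finite_verts finite_subset by blast+
  have unique: "t = t'" if "leaf G s" "(s, t) \<in> parcs G" "(s, t') \<in> parcs G" for s t t'
  proof -
    have "card {w. (s, w) \<in> parcs G} = 1" using that(1) by (simp add: leaf_iff)
    then obtain y where "{w. (s, w) \<in> parcs G} = {y}" by (rule card_1_singletonE)
    then show ?thesis using that(2,3) by (metis mem_Collect_eq singletonD)
  qed
  have A: "leaf G s \<and> (s, u) \<in> parcs G" if "s \<in> A" for s
    using that arc_sym unfolding A_def leaf_neighbors_def by blast
  have B: "leaf G s \<and> (s, v) \<in> parcs G" if "s \<in> B" for s
    using that arc_sym unfolding B_def leaf_neighbors_def by blast
  have disj: "A \<inter> B = {}" using A B unique dsc(6) by blast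
  have notin: "u \<notin> A \<union> B" "v \<notin> A \<union> B" using A B uv by blast+
  have "card (insert u (insert v (A \<union> B))) = a + b + 2"
    using fin disj notin dsc(6,8,9) by (simp add: card_Un_disjoint)
  then have V: "insert u (insert v (A \<union> B)) = pverts G"
    using dsc(4) pair_finite_verts uv sub by (intro card_seteq) auto
  have "parcs G = double_star_arcs u v A B"
  proof (intro equalityI subrelI)
    fix s t assume st: "(s, t) \<in> parcs G"
    then have "s \<in> pverts G" "t \<in> pverts G" "s \<noteq> t" using in_arcsD1 in_arcsD2 arc_irrefl by blast+
    moreover have "t = u" if "s \<in> A" using A[OF that] st unique by blast
    moreover have "t = v" if "s \<in> B" using B[OF that] st unique by blast
    moreover have "(t, s) \<in> parcs G" using st arc_sym by blast
    moreover have "s = u" if "t \<in> A" using A[OF that] \<open>(t, s) \<in> parcs G\<close> unique by blast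
    moreover have "s = v" if "t \<in> B" using B[OF that] \<open>(t, s) \<in> parcs G\<close> unique by blast
    ultimately show "(s, t) \<in> double_star_arcs u v A B"
      unfolding double_star_arcs_iff V[symmetric] by blast
  next
    fix s t assume "(s, t) \<in> double_star_arcs u v A B"
    then show "(s, t) \<in> parcs G"
      unfolding double_star_arcs_iff using A B dsc(7) arc_sym by blast
  qed
  then show thesis using that[of A B] V fin dsc disj notin by simp
qed

lemma double_star_centers_commute:
  assumes "double_star_centers a b G u v"
  shows "double_star_centers b a G v u"
proof -
  have "pair_graph G" using assms by (simp add: double_star_centers_def is_tree_def)
  then have "(v, u) \<in> parcs G"
    using assms pair_graph.arc_sym by (fastforce simp: double_star_centers_def)
  then show ?thesis using assms by (auto simp: double_star_centers_def insert_commute)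
qed

lemma double_star_commute: "double_star a b G \<Longrightarrow> double_star b a G"
  unfolding double_star_def using double_star_centers_commute by metis

lemma subdivided_double_star_commute:
  "subdivided_double_star a b G \<Longrightarrow> subdivided_double_star b a G"
  unfolding subdivided_double_star_def
  using double_star_centers_commute by (fastforce simp: subdivide.simps insert_commute)

context pair_graph
begin

section \<open>From stems to stars, double-stars and subdivided double-stars\<close>

lemma star_iff_bipartite:
  "complete_bipartite_digraph 1 (card (pverts G) - 1) (with_proj G) \<longleftrightarrow> (\<exists>c. star G c (pverts G))"
proof
  assume "complete_bipartite_digraph 1 (card (pverts G) - 1) (with_proj G)"
  then obtain U V where UV: "pverts G = U \<union> V" "U \<inter> V = {}" "card U = 1" "parcs G = U \<times> V \<union> V \<times> U"
    unfolding complete_bipartite_digraph_pair_def by blast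
  obtain c where "U = {c}" using UV(3) by (rule card_1_singletonE)
  then have "star G c (pverts G)" using UV unfolding star_def by auto
  then show "\<exists>c. star G c (pverts G)" ..
next
  assume "\<exists>c. star G c (pverts G)"
  then obtain c where c: "c \<in> pverts G"
    and arc: "\<And>a b. a \<in> pverts G \<Longrightarrow> b \<in> pverts G \<Longrightarrow> (a, b) \<in> parcs G \<longleftrightarrow> (a = c) \<noteq> (b = c)"
    unfolding star_def by blast
  have "parcs G = {c} \<times> (pverts G - {c}) \<union> (pverts G - {c}) \<times> {c}" (is "_ = ?R")
  proof (intro equalityI subrelI)
    fix a b assume ab: "(a, b) \<in> parcs G"
    then have "a \<in> pverts G" "b \<in> pverts G" using in_arcsD1 in_arcsD2 by blast+
    then show "(a, b) \<in> ?R" using arc[of a b] ab by blast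
  next
    fix a b assume "(a, b) \<in> ?R"
    then show "(a, b) \<in> parcs G" using arc[of a b] c by blast
  qed
  then show "complete_bipartite_digraph 1 (card (pverts G) - 1) (with_proj G)"
    unfolding complete_bipartite_digraph_pair_def
    using pair_finite_verts insert_Diff[OF c] card_Diff_singleton[OF c]
    by (intro conjI exI[of _ "{c}"] exI[of _ "pverts G - {c}"]) simp_all
qed

text \<open>The stem determines all arcs that meet \<open>R\<close> or \<open>v\<close>, and the
  star all others.\<close>

lemma stem_arcs:
  assumes "stem G v x R (pverts G)" "star G c (pverts G - insert v R)"
  shows "parcs G = (let S = {v} \<times> R \<union> {(v, x)} \<union> {c} \<times> (pverts G - insert v R - {c}) in S \<union> S\<inverse>)"
    (is "_ = ?E")
proof -
  define A where "A = pverts G - insert v R"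
  have st: "R \<subseteq> pverts G" "v \<in> pverts G" "v \<notin> R" "x \<in> A"
    "\<And>w y. w \<in> R \<Longrightarrow> y \<in> pverts G \<Longrightarrow> (w, y) \<in> parcs G \<longleftrightarrow> y = v"
    "\<And>y. y \<in> A \<Longrightarrow> (v, y) \<in> parcs G \<longleftrightarrow> y = x"
    using assms(1) unfolding stem_def pendants_def A_def by blast+
  have sc: "c \<in> A" "\<And>a b. a \<in> A \<Longrightarrow> b \<in> A \<Longrightarrow> (a, b) \<in> parcs G \<longleftrightarrow> (a = c) \<noteq> (b = c)"
    using assms(2) unfolding star_def A_def by blast+
  have E: "(s, t) \<in> ?E \<longleftrightarrow> s = v \<and> t \<in> R \<or> t = v \<and> s \<in> R \<or> s = v \<and> t = x \<or> t = v \<and> s = x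
      \<or> s = c \<and> t \<in> A \<and> t \<noteq> c \<or> t = c \<and> s \<in> A \<and> s \<noteq> c" for s t
    by (auto simp: A_def Let_def)
  have V: "s \<in> pverts G \<longleftrightarrow> s = v \<or> s \<in> R \<or> s \<in> A" for s using st A_def by blast
  have vA: "v \<notin> A" "A \<inter> R = {}" using A_def by auto
  have "(s, t) \<in> parcs G \<longleftrightarrow> (s, t) \<in> ?E" if "s \<in> pverts G" "t \<in> pverts G" for s t
  proof -
    from that consider "s \<in> R" | "t \<in> R" | "s = v" "t = v" | "s = v" "t \<in> A" | "t = v" "s \<in> A" | "s \<in> A" "t \<in> A"
      unfolding V by blast
    then show ?thesis
    proof cases
      case 1
      then show ?thesis unfolding E using 1 st(5)[OF 1 that(2)] st(3,4) sc(1) vA by blast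
    next
      case 2
      then have "(s, t) \<in> parcs G \<longleftrightarrow> s = v" using st(5)[OF 2 that(1)] arc_sym by blast
      then show ?thesis unfolding E using 2 st(3,4) sc(1) vA by blast
    next
      case 3
      then show ?thesis unfolding E using arc_irrefl st(3,4) sc(1) vA by blast
    next
      case 4
      then show ?thesis unfolding E using st(6)[OF 4(2)] st(3,4) sc(1) vA by blast
    next
      case 5
      then have "(s, t) \<in> parcs G \<longleftrightarrow> s = x" using st(6)[OF 5(2)] arc_sym by blast
      then show ?thesis unfolding E using 5 st(3,4) sc(1) vA by blast
    next
      case 6
      then show ?thesis unfolding E using sc(2)[OF 6] sc(1) vA by blast
    qed
  qed
  moreover have "(s, t) \<in> ?E \<Longrightarrow> s \<in> pverts G \<and> t \<in> pverts G" for s t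
    unfolding E V using st(4) sc(1) by blast
  ultimately show ?thesis using in_arcsD1 in_arcsD2 by (intro set_eqI) (metis prod.collapse)
qed

text \<open>The centers are \<open>v\<close> and \<open>x\<close>; all vertices of the remaining
  star except \<open>x\<close> are leaves at \<open>x\<close>.\<close>

lemma stem_center_double_star:
  assumes "stem G v x R (pverts G)" "star G x (pverts G - insert v R)"
    and "2 \<le> card (pverts G - insert v R)"
  shows "double_star (card R) (card (pverts G - insert v R) - 1) G"
proof -
  define B where "B = pverts G - insert v R - {x}"
  have st: "R \<subseteq> pverts G" "v \<in> pverts G" "v \<notin> R" "R \<noteq> {}" "x \<in> pverts G - insert v R"
    using assms(1) unfolding stem_def pendants_def by blast+
  have finB: "finite B" "finite R" using pair_finite_verts finite_subset[OF st(1) pair_finite_verts] unfolding B_def by auto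
  have cB: "card B = card (pverts G - insert v R) - 1"
    unfolding B_def using st(5) pair_finite_verts by (intro card_Diff_singleton) auto
  have "double_star_centers (card R) (card B) G v x"
  proof (rule double_star_centersI)
    show "pverts G = insert v (insert x (R \<union> B))" using st B_def by blast
    show "parcs G = double_star_arcs v x R B"
      using stem_arcs[OF assms(1,2)] by (auto simp: double_star_arcs_def Let_def B_def)
    show "B \<noteq> {}" using cB assms(3) by auto
  qed (use finB st B_def in auto)
  then show ?thesis using cB double_star_def by metis
qed

text \<open>The leaf \<open>x\<close> of the remaining star is the vertex subdividing the edge
  between \<open>v\<close> and \<open>c\<close>, so \<open>c\<close> keeps two fewer leaves than the
  star has vertices.\<close>

lemma stem_leaf_subdivided_double_star:
  assumes "stem G v x R (pverts G)" "star G c (pverts G - insert v R)" "x \<noteq> c"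
    and "3 \<le> card (pverts G - insert v R)"
  shows "subdivided_double_star (card R) (card (pverts G - insert v R) - 2) G"
proof -
  define B where "B = pverts G - insert v R - {c, x}"
  have st: "R \<subseteq> pverts G" "v \<in> pverts G" "v \<notin> R" "R \<noteq> {}" "x \<in> pverts G - insert v R"
    using assms(1) unfolding stem_def pendants_def by blast+
  have c: "c \<in> pverts G - insert v R" using assms(2) by (simp add: star_def)
  have fin: "finite B" "finite R" using pair_finite_verts finite_subset[OF st(1) pair_finite_verts] unfolding B_def by auto
  have "card (pverts G - insert v R - {c, x}) = card (pverts G - insert v R) - card {c, x}"
    using st(5) c by (intro card_Diff_subset) auto
  then have cB: "card B = card (pverts G - insert v R) - 2"
    unfolding B_def using assms(3) by simp
  define H where "H = \<lparr>pverts = insert v (insert c (R \<union> B)), parcs = double_star_arcs v c R B\<rparr>"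
  have "double_star_centers (card R) (card B) H v c"
  proof (rule double_star_centersI)
    show "pverts H = insert v (insert c (R \<union> B))" "parcs H = double_star_arcs v c R B"
      by (simp_all add: H_def)
    have "card B \<noteq> 0" using cB assms(4) by simp
    then show "B \<noteq> {}" by auto
  qed (use fin st c B_def in auto)
  moreover have "x \<notin> pverts H" using st c assms(3) by (auto simp: H_def B_def)
  moreover have "G = subdivide H (v, c) x"
  proof -
    have "pverts G = insert x (pverts H)" using st c by (auto simp: H_def B_def)
    moreover have "parcs G = (parcs H - {(v, c), (c, v)}) \<union> {(v, x), (x, v), (x, c), (c, x)}"
    proof -
      have "pverts G - insert v R - {c} = insert x B" using st assms(3) B_def by blast
      then have "parcs G = (let S = {v} \<times> R \<union> {(v, x)} \<union> {c} \<times> insert x B in S \<union> S\<inverse>)"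
        using stem_arcs[OF assms(1,2)] by simp
      moreover have "c \<notin> R" "v \<notin> B" "v \<notin> R" "c \<notin> B" "v \<noteq> c" using c st B_def by auto
      ultimately show ?thesis unfolding H_def double_star_arcs_def Let_def by auto
    qed
    ultimately show ?thesis by (simp add: subdivide.simps)
  qed
  ultimately show ?thesis unfolding subdivided_double_star_def using cB by metis
qed

section \<open>Upper bounds for the listed trees\<close>

text \<open>Painter splits off the stem \<open>u\<close> with its \<open>a\<close> leaves, after
  which a star with \<open>b\<close> leaves remains. The first center carries the stricter
  threshold.\<close>

lemma double_star_cost_le:
  assumes "double_star a b G" "Suc a < tri (Suc k)" "b < tri (Suc l)"
  shows "cost G (pverts G) \<le> a + b + 2 + k + l"
proof -
  obtain u v where "double_star_centers a b G u v" using assms(1) unfolding double_star_def by blast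
  then obtain A B where V: "pverts G = insert u (insert v (A \<union> B))" and E: "parcs G = double_star_arcs u v A B"
    and AB: "finite A" "finite B" "card A = a" "card B = b"
    and disj: "u \<noteq> v" "A \<inter> B = {}" "u \<notin> A \<union> B" "v \<notin> A \<union> B"
    by (rule double_star_centersE)
  have "cost G (pverts G) \<le> cost G (pverts G - insert u A) + card A + 1 + k"
  proof (rule cost_remove_stem_le)
    show "pendants G u A (pverts G)"
      unfolding pendants_def V E double_star_arcs_iff using disj by blast
    show "y = v" if "y \<in> pverts G - A" "(u, y) \<in> parcs G" for y
      using that disj unfolding V E double_star_arcs_iff by blast
  qed (use pair_finite_verts AB disj assms in auto)
  also have "pverts G - insert u A = insert v B" unfolding V using disj by blast
  also have "cost G (insert v B) \<le> card (insert v B) + l"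
  proof (rule star_cost_le)
    show "star G v (insert v B)"
      unfolding star_def E double_star_arcs_iff using disj by blast
  qed (use AB disj assms in auto)
  finally show ?thesis using AB disj by simp
qed

text \<open>Splitting off one end leaves a star in which the subdividing vertex is an additional
  leaf, hence \<open>Suc b\<close> in the second threshold.\<close>

lemma subdivided_double_star_cost_le:
  assumes "subdivided_double_star a b G" "Suc a < tri (Suc k)" "Suc b < tri (Suc l)"
  shows "cost G (pverts G) \<le> a + b + 3 + k + l"
proof -
  obtain H u v w where H: "double_star_centers a b H u v" "w \<notin> pverts H" "G = subdivide H (u, v) w"
    using assms(1) unfolding subdivided_double_star_def by blast
  obtain A B where VH: "pverts H = insert u (insert v (A \<union> B))" and EH: "parcs H = double_star_arcs u v A B"
    and AB: "finite A" "finite B" "card A = a" "card B = b"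
    and disj: "u \<noteq> v" "A \<inter> B = {}" "u \<notin> A \<union> B" "v \<notin> A \<union> B"
    using H(1) by (rule double_star_centersE)
  have V: "pverts G = insert w (insert u (insert v (A \<union> B)))"
    using H(3) VH by (simp add: subdivide.simps)
  have E: "(s, t) \<in> parcs G \<longleftrightarrow> (s, t) \<in> double_star_arcs u v A B \<and> (s, t) \<noteq> (u, v) \<and> (s, t) \<noteq> (v, u)
      \<or> (s, t) \<in> {(u, w), (w, u), (w, v), (v, w)}" for s t
    using H(3) EH by (simp add: subdivide.simps) blast
  have w: "w \<noteq> u" "w \<noteq> v" "w \<notin> A" "w \<notin> B" using H(2) VH by auto
  have "cost G (pverts G) \<le> cost G (pverts G - insert u A) + card A + 1 + k"
  proof (rule cost_remove_stem_le)
    show "pendants G u A (pverts G)"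
      unfolding pendants_def V E double_star_arcs_iff using disj w by auto
    show "y = w" if "y \<in> pverts G - A" "(u, y) \<in> parcs G" for y
      using that disj w unfolding V E double_star_arcs_iff by auto
  qed (use pair_finite_verts AB disj assms w in auto)
  also have "pverts G - insert u A = insert v (insert w B)" unfolding V using disj w by blast
  also have "cost G (insert v (insert w B)) \<le> card (insert v (insert w B)) + l"
  proof (rule star_cost_le)
    show "star G v (insert v (insert w B))"
      unfolding star_def E double_star_arcs_iff using disj w by auto
  qed (use AB disj assms w in auto)
  finally show ?thesis using AB disj w by simp
qed

end

lemma double_star_card: "double_star a b G \<Longrightarrow> card (pverts G) = a + b + 2 \<and> 1 \<le> a \<and> 1 \<le> b"
  by (auto simp: double_star_def double_star_centers_def)

lemma subdivided_double_star_card: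
  assumes "subdivided_double_star a b G"
  shows "card (pverts G) = a + b + 3 \<and> 1 \<le> a \<and> 1 \<le> b"
proof -
  obtain H u v w where H: "double_star_centers a b H u v" "w \<notin> pverts H" "G = subdivide H (u, v) w"
    using assms unfolding subdivided_double_star_def by blast
  then interpret H: pair_graph H by (simp add: double_star_centers_def is_tree_def)
  show ?thesis
    using H H.pair_finite_verts by (simp add: double_star_centers_def subdivide.simps)
qed

lemma exists_star_tree:
  assumes "finite V" "c \<in> V"
  obtains S where "is_tree S" "pverts S = V" "star S c V"
proof -
  define S where "S = \<lparr>pverts = V, parcs = {c} \<times> (V - {c}) \<union> (V - {c}) \<times> {c}\<rparr>"
  have S: "pverts S = V" "parcs S = {c} \<times> (V - {c}) \<union> (V - {c}) \<times> {c}" by (simp_all add: S_def)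
  interpret S: pair_graph S
  proof
    show "symmetric (with_proj S)" by (auto simp: symmetric_def S sym_def)
  qed (use assms in \<open>auto simp: S\<close>)
  have "rooted S V c (\<lambda>_. c) (\<lambda>w. if w = c then 0 else 1)"
    unfolding rooted_def S using assms by auto
  then have "is_tree S" using S.tree_on_imp_is_tree S(1) unfolding tree_on_def by blast
  moreover have "star S c V" unfolding star_def S using assms by auto
  ultimately show thesis using that S(1) by blast
qed

section \<open>The classification\<close>

theorem theorem4p4:
  fixes n :: nat and T :: "'a pair_pre_digraph"
  assumes "1 \<le> n"
    and "triangular (n - 1) \<or> triangular (n - 2)"
    and "is_tree T" and "card (pverts T) = n"
  shows "is_arg_min sum_color_cost (\<lambda>T'. is_tree T' \<and> card (pverts T') = n) T \<longleftrightarrow>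
    complete_bipartite_digraph 1 (n - 1) (with_proj T)
    \<or> double_star 1 (n - 3) T
    \<or> double_star 2 (n - 4) T
    \<or> subdivided_double_star 1 (n - 4) T
    \<or> n = 7
    \<or> n = 11 \<and> (double_star 4 5 T \<or> subdivided_double_star 4 4 T)"
    (is "_ \<longleftrightarrow> ?list")
proof -
  obtain K where K: "1 \<le> K" "tri K < n" "n \<le> tri K + 2"
  proof -
    from assms(2) obtain K where K: "1 \<le> K" "n - 1 = tri K \<or> n - 2 = tri K"
      unfolding triangular_iff_tri by blast
    \<comment> \<open>Positivity excludes truncation in \<open>n - 1\<close> and
      \<open>n - 2\<close>.\<close>
    moreover have "1 \<le> tri K" using K(1) le_tri[of K] by linarith
    ultimately show thesis using that[of K] by auto
  qed
  \<comment> \<open>In the trees valid for all \<open>n\<close>, one end has overhead 1, which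
    leaves \<open>L\<close> for the other.\<close>
  define L where "L = K - 1"
  have L: "K = Suc L" using K(1) L_def by simp
  interpret pair_graph T using assms(3) by (simp add: is_tree_def)
  have tree: "tree_on T (pverts T)" using assms(3) by (rule is_tree_imp_tree_on)
  have lower: "n + K \<le> sum_color_cost T'" if T': "is_tree T'" "card (pverts T') = n"
    for T' :: "'a pair_pre_digraph"
  proof -
    interpret T': pair_graph T' using T'(1) by (simp add: is_tree_def)
    show ?thesis
      using T'.tree_cost_ge[OF T'.is_tree_imp_tree_on[OF T'(1)], of K] T' K T'.sum_color_cost_eq by simp
  qed
  have large: "n \<le> tri (Suc K)" using K by simp
  \<comment> \<open>A star on the vertex set of \<open>T\<close> is a competitor attaining the lower
    bound, so minimality of \<open>T\<close> means cost at most \<open>n + K\<close>.\<close>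
  obtain c where "c \<in> pverts T" using assms(1,4) by fastforce
  then obtain S where S: "is_tree S" "pverts S = pverts T" "star S c (pverts T)"
    using exists_star_tree pair_finite_verts by metis
  interpret S: pair_graph S using S(1) by (simp add: is_tree_def)
  have "sum_color_cost S \<le> n + K"
    using S.star_cost_le[OF pair_finite_verts S(3), of K] S.sum_color_cost_eq S(2) large assms(4) by simp
  then have "is_arg_min sum_color_cost (\<lambda>T'. is_tree T' \<and> card (pverts T') = n) T
      \<longleftrightarrow> sum_color_cost T \<le> n + K"
    using lower S(1,2) assms(3,4) unfolding is_arg_min_def by (metis le_trans not_le)
  also have "\<dots> \<longleftrightarrow> cost T (pverts T) \<le> n + K" by (simp add: sum_color_cost_eq)
  also have "\<dots> \<longleftrightarrow> ?list"
  proof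
    assume cost: "cost T (pverts T) \<le> n + K"
    show ?list
    proof (cases "n = 7 \<or> (\<exists>c. star T c (pverts T))")
      case True
      then show ?thesis using star_iff_bipartite assms(4) by auto
    next
      case False
      then obtain v x R c where st: "stem T v x R (pverts T)" and star: "star T c (pverts T - insert v R)"
        and two: "2 \<le> card (pverts T - insert v R)"
        and alt: "x = c \<and> (card (pverts T - insert v R) \<in> {2, 3} \<or> card R \<in> {1, 2}
              \<or> n = 11 \<and> card R \<in> {4, 5})
          \<or> x \<noteq> c \<and> (card (pverts T - insert v R) = 3 \<or> card R = 1 \<and> 3 \<le> card (pverts T - insert v R)
              \<or> n = 11 \<and> card R = 4)"
        using minimal_tree_shape[OF tree, of K] cost K(2) assms(4) by blast
      define a where "a = card R"
      define b where "b = card (pverts T - insert v R)"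
      have n: "n = a + b + 1" "2 \<le> b"
        using stem_card[OF pair_finite_verts st] assms(4) two by (simp_all add: a_def b_def)
      have ds: "double_star a (b - 1) T" if "x = c"
        using stem_center_double_star[OF st] star two that by (simp add: a_def b_def)
      have sds: "subdivided_double_star a (b - 2) T" if "x \<noteq> c" "3 \<le> b"
        using stem_leaf_subdivided_double_star[OF st star] that by (simp add: a_def b_def)
      from alt consider "x = c" "b = 2" | "x = c" "b = 3" | "x = c" "a = 1" | "x = c" "a = 2"
        | "x = c" "n = 11" "a = 4" | "x = c" "n = 11" "a = 5"
        | "x \<noteq> c" "b = 3" | "x \<noteq> c" "a = 1" "3 \<le> b" | "x \<noteq> c" "n = 11" "a = 4"
        unfolding a_def[symmetric] b_def[symmetric] by blast
      then show ?thesis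
      proof cases
        case 1
        then show ?thesis using double_star_commute[OF ds] n by simp
      next
        case 2
        then show ?thesis using double_star_commute[OF ds] n by simp
      next
        case 3
        then show ?thesis using ds n by simp
      next
        case 4
        then show ?thesis using ds n by simp
      next
        case 5
        then show ?thesis using ds n by simp
      next
        case 6
        then have "double_star 5 4 T" using ds n by simp
        then show ?thesis using double_star_commute 6 by blast
      next
        case 7
        then show ?thesis using subdivided_double_star_commute[OF sds] n by simp
      next
        case 8
        then show ?thesis using sds n by simp
      next
        case 9
        then show ?thesis using sds n by simp
      qed
    qed
  next
    assume ?list
    then consider "\<exists>c. star T c (pverts T)" | "double_star 1 (n - 3) T" | "double_star 2 (n - 4) T"
      | "subdivided_double_star 1 (n - 4) T" | "n = 7"
      | "n = 11" "double_star 4 5 T" | "n = 11" "subdivided_double_star 4 4 T"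
      using star_iff_bipartite assms(4) by auto
    then show "cost T (pverts T) \<le> n + K"
    proof cases
      case 1
      then show ?thesis using star_cost_le[OF pair_finite_verts _] large assms(4) by blast
    next
      case 2
      \<comment> \<open>The end with one leaf is split off with \<open>k = 1\<close>; the other
        threshold \<open>n - 3 < tri K\<close> is where \<open>n \<le> tri K + 2\<close>
        enters.\<close>
      have "cost T (pverts T) \<le> 1 + (n - 3) + 2 + 1 + L"
        using K L double_star_card[OF 2] by (intro double_star_cost_le[OF 2]) auto
      then show ?thesis using L double_star_card[OF 2] assms(4) by linarith
    next
      case 3
      \<comment> \<open>The ends are exchanged: two leaves have overhead 1 in the final star, but
        would need \<open>k = 2\<close> as the stem split off first.\<close>
      have "cost T (pverts T) \<le> (n - 4) + 2 + 2 + L + 1"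
        using K L double_star_card[OF 3] assms(4)
        by (intro double_star_cost_le[OF double_star_commute[OF 3]]) auto
      then show ?thesis using L double_star_card[OF 3] assms(4) by linarith
    next
      case 4
      have "cost T (pverts T) \<le> 1 + (n - 4) + 3 + 1 + L"
        using K L subdivided_double_star_card[OF 4] assms(4)
        by (intro subdivided_double_star_cost_le[OF 4]) auto
      then show ?thesis using L subdivided_double_star_card[OF 4] assms(4) by linarith
    next
      case 5
      \<comment> \<open>Here \<open>K = 3\<close>, and half of \<open>3 * 7\<close>, rounded down,
        is \<open>7 + 3\<close>.\<close>
      have "tri 2 < tri K" using K 5 by (simp add: numeral_2_eq_2)
      then have "3 \<le> K" using tri_less_imp_less by fastforce
      then show ?thesis using tree_cost_upper[OF tree] assms(4) 5 by linarith
    next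
      case 6
      \<comment> \<open>Here \<open>K = 4\<close>, and both ends are played with overhead 2.\<close>
      have "tri 3 < tri K" using K 6 by (simp add: numeral_3_eq_3)
      then have "4 \<le> K" using tri_less_imp_less by fastforce
      moreover have "cost T (pverts T) \<le> 4 + 5 + 2 + 2 + 2"
        by (intro double_star_cost_le[OF 6(2)]) (simp_all add: numeral_2_eq_2)
      ultimately show ?thesis using 6 by simp
    next
      case 7
      have "tri 3 < tri K" using K 7 by (simp add: numeral_3_eq_3)
      then have "4 \<le> K" using tri_less_imp_less by fastforce
      moreover have "cost T (pverts T) \<le> 4 + 4 + 3 + 2 + 2"
        by (intro subdivided_double_star_cost_le[OF 7(2)]) (simp_all add: numeral_2_eq_2)
      ultimately show ?thesis using 7 by simp
    qed
  qed
  finally show ?thesis .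
qed

end
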